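(* Let $(W,S)$ be an infinite irreducible Coxeter system of finite rank and let $c \in W$ be a Coxeter element. Then the centralizer of $c$ in $W$ is $C_W(c)=\langle c \rangle$, the cyclic subgroup generated by $c$.
   Context: A Coxeter system $(W,S)$ is a group $W$ with a presentation $W=\langle S \mid (st)^{m_{st}}=1 \ \forall s,t\in S\rangle$, where $(m_{st})$ is a symmetric matrix with entries in $\mathbb{Z}_{\ge 1}\cup\{\infty\}$, $m_{ss}=1$, and $m_{st}\ge 2$ for $s\ne t$ (no relation if $m_{st}=\infty$). Its rank is $|S|$; it is called infinite if $W$ is infinite. The Coxeter diagram has vertex set $S$ and an edge between distinct $s,t$ whenever $m_{st}>2$; $(W,S)$ is irreducible if this diagram is connected. If $S=\{s_1,\dots,s_n\}$, a standard Coxeter element is an element $s_{\pi(1)}\cdots s_{\pi(n)}$ for some permutation $\pi$ of $\{1,\dots,n\}$; a Coxeter element is any conjugate in $W$ of a standard Coxeter element. *)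

theory Defs
  imports "HOL-Algebra.Generated_Groups" "HOL-Library.Extended_Nat"
begin

section \<open>Group presentations\<close>

text \<open>A letter \<open>(s, True)\<close> stands for the generator \<open>s\<close>, a letter \<open>(s, False)\<close> for its formal
  inverse.\<close>

type_synonym 'a word = "('a \<times> bool) list"

definition words :: "'a set \<Rightarrow> 'a word set" where
  "words S = lists (S \<times> UNIV)"

text \<open>Equality in the abstract group with generators \<open>S\<close> and relators \<open>R\<close>: the congruence on the
  monoid of words generated by free cancellation and by deletion of relators.\<close>

inductive word_equiv :: "'a set \<Rightarrow> 'a word set \<Rightarrow> 'a word \<Rightarrow> 'a word \<Rightarrow> bool"
  for S :: "'a set" and R :: "'a word set" where
  refl: "u \<in> words S \<Longrightarrow> word_equiv S R u u"
| sym: "word_equiv S R u v \<Longrightarrow> word_equiv S R v u"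
| trans: "word_equiv S R u v \<Longrightarrow> word_equiv S R v w \<Longrightarrow> word_equiv S R u w"
| cancel: "u \<in> words S \<Longrightarrow> v \<in> words S \<Longrightarrow> s \<in> S \<Longrightarrow>
    word_equiv S R (u @ [(s, b), (s, \<not> b)] @ v) (u @ v)"
| relator: "u \<in> words S \<Longrightarrow> v \<in> words S \<Longrightarrow> r \<in> R \<Longrightarrow> r \<in> words S \<Longrightarrow>
    word_equiv S R (u @ r @ v) (u @ v)"

definition list_prod :: "('a, 'b) monoid_scheme \<Rightarrow> 'a list \<Rightarrow> 'a" where
  "list_prod G xs = foldr (\<otimes>\<^bsub>G\<^esub>) xs \<one>\<^bsub>G\<^esub>"

definition eval_word :: "('a, 'b) monoid_scheme \<Rightarrow> 'a word \<Rightarrow> 'a" where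
  "eval_word G w = list_prod G (map (\<lambda>(s, b). if b then s else inv\<^bsub>G\<^esub> s) w)"

text \<open>\<open>G = \<langle>S | R\<rangle>\<close>, for a subset \<open>S\<close> of \<open>G\<close>: the evaluation map from the abstractly presented group
  to \<open>G\<close> is surjective, well defined and injective.\<close>

definition presented_by :: "('a, 'b) monoid_scheme \<Rightarrow> 'a set \<Rightarrow> 'a word set \<Rightarrow> bool" where
  "presented_by G S R \<longleftrightarrow>
     group G \<and> S \<subseteq> carrier G \<and> R \<subseteq> words S \<and> generate G S = carrier G \<and>
     (\<forall>u \<in> words S. \<forall>v \<in> words S. eval_word G u = eval_word G v \<longleftrightarrow> word_equiv S R u v)"


section \<open>Coxeter systems\<close>

definition coxeter_matrix :: "'a set \<Rightarrow> ('a \<Rightarrow> 'a \<Rightarrow> enat) \<Rightarrow> bool" where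
  "coxeter_matrix S m \<longleftrightarrow>
     (\<forall>s \<in> S. \<forall>t \<in> S. m s t = m t s) \<and>
     (\<forall>s \<in> S. m s s = 1) \<and>
     (\<forall>s \<in> S. \<forall>t \<in> S. s \<noteq> t \<longrightarrow> m s t \<ge> 2)"

text \<open>The words \<open>(st)\<^sup>k\<close> with \<open>k = m s t\<close> finite; an infinite entry contributes no relator.\<close>

definition coxeter_relators :: "'a set \<Rightarrow> ('a \<Rightarrow> 'a \<Rightarrow> enat) \<Rightarrow> 'a word set" where
  "coxeter_relators S m =
     {concat (replicate k [(s, True), (t, True)]) | s t k. s \<in> S \<and> t \<in> S \<and> m s t = enat k}"

definition coxeter_system ::
    "('a, 'b) monoid_scheme \<Rightarrow> 'a set \<Rightarrow> ('a \<Rightarrow> 'a \<Rightarrow> enat) \<Rightarrow> bool" where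
  "coxeter_system W S m \<longleftrightarrow> coxeter_matrix S m \<and> presented_by W S (coxeter_relators S m)"

definition coxeter_diagram :: "'a set \<Rightarrow> ('a \<Rightarrow> 'a \<Rightarrow> enat) \<Rightarrow> ('a \<times> 'a) set" where
  "coxeter_diagram S m = {(s, t). s \<in> S \<and> t \<in> S \<and> s \<noteq> t \<and> m s t > 2}"

text \<open>The edge relation is symmetric, so connectedness is reachability between any two vertices.\<close>

definition coxeter_irreducible :: "'a set \<Rightarrow> ('a \<Rightarrow> 'a \<Rightarrow> enat) \<Rightarrow> bool" where
  "coxeter_irreducible S m \<longleftrightarrow> (\<forall>s \<in> S. \<forall>t \<in> S. (s, t) \<in> (coxeter_diagram S m)\<^sup>*)"

text \<open>The orderings \<open>s\<^bsub>\<pi>(1)\<^esub>, \<dots>, s\<^bsub>\<pi>(n)\<^esub>\<close> of a finite set \<open>S\<close> are the repetition-free lists that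
  enumerate it.\<close>

definition standard_coxeter_element :: "('a, 'b) monoid_scheme \<Rightarrow> 'a set \<Rightarrow> 'a \<Rightarrow> bool" where
  "standard_coxeter_element W S c \<longleftrightarrow>
     (\<exists>xs. distinct xs \<and> set xs = S \<and> c = list_prod W xs)"

definition coxeter_element :: "('a, 'b) monoid_scheme \<Rightarrow> 'a set \<Rightarrow> 'a \<Rightarrow> bool" where
  "coxeter_element W S c \<longleftrightarrow>
     (\<exists>w \<in> carrier W. \<exists>d. standard_coxeter_element W S d \<and> c = w \<otimes>\<^bsub>W\<^esub> d \<otimes>\<^bsub>W\<^esub> inv\<^bsub>W\<^esub> w)"

definition centralizer :: "('a, 'b) monoid_scheme \<Rightarrow> 'a \<Rightarrow> 'a set" where
  "centralizer G x = {g \<in> carrier G. g \<otimes>\<^bsub>G\<^esub> x = x \<otimes>\<^bsub>G\<^esub> g}"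

end

theory Submission
  imports Defs Complex_Main "HOL-Combinatorics.Cycles"
begin

text \<open>Let \<open>W\<close> act on its geometric representation, and let \<open>\<beta>\<^sub>i = s\<^sub>1\<cdots>s\<^bsub>i-1\<^esub>(\<alpha>\<^sub>i)\<close> be the inversions of
  \<open>c = s\<^sub>1\<cdots>s\<^sub>n\<close>. The Euler form \<open>E\<close>, a triangular form whose symmetrization is the invariant form and
  which satisfies \<open>E(c x, y) = - E(y, x)\<close>, reads off coordinates: \<open>E(\<beta>\<^sub>i, y) = y\<^sub>i\<close>. For infinite
  irreducible \<open>W\<close> it follows that \<open>c\<^sup>k \<beta>\<^sub>i\<close> is positive exactly when \<open>k \<ge> 0\<close>. An element \<open>w\<close> that
  commutes with \<open>c\<close> has only finitely many inversions, so \<open>w\<close> permutes the \<open>c\<close>-orbits of the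
  \<open>\<beta>\<^sub>i\<close>, say \<open>w \<beta>\<^sub>i = c\<^bsup>a(i)\<^esup> \<beta>\<^bsub>\<sigma>(i)\<^esub>\<close>. If \<open>w\<close> preserves \<open>E\<close>, this says that \<open>w\<close> maps the
  \<open>i\<close>-th fundamental weight to \<open>c\<^bsup>a(i)\<^esup>\<close> times the \<open>\<sigma>(i)\<close>-th one, so \<open>\<sigma>\<close> is the identity, and
  irreducibility together with the sign pattern of \<open>c\<^sup>k \<beta>\<^sub>i\<close> forces \<open>a\<close> to be constant. That \<open>w\<close>
  preserves \<open>E\<close> is clear for a nondegenerate invariant form. In general \<open>E(w x, w y) - E(x, y)\<close> is a
  skew form that is \<open>c\<close>-invariant in each argument; it vanishes in the affine case because it lives on
  a one-dimensional quotient, and in the indefinite case because a \<open>c\<close>-invariant shift of a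
  fundamental weight within its \<open>W\<close>-orbit would produce a positive radical vector.\<close>

section \<open>Reflection representations\<close>

type_synonym vec = "nat \<Rightarrow> real"

definition bvec :: "nat \<Rightarrow> vec" where
  "bvec i = (\<lambda>j. if j = i then 1 else 0)"

definition nonneg :: "vec \<Rightarrow> bool" where
  "nonneg x \<longleftrightarrow> (\<forall>j. 0 \<le> x j)"

definition nonpos :: "vec \<Rightarrow> bool" where
  "nonpos x \<longleftrightarrow> (\<forall>j. x j \<le> 0)"

locale cartan_matrix =
  fixes n :: nat and a :: "nat \<Rightarrow> nat \<Rightarrow> real"
  assumes diag: "i < n \<Longrightarrow> a i i = 2"
    and symm: "i < n \<Longrightarrow> j < n \<Longrightarrow> a i j = a j i"
    and offdiag: "i < n \<Longrightarrow> j < n \<Longrightarrow> i \<noteq> j \<Longrightarrow> a i j \<le> 0"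
begin

text \<open>\<open>vec\<close> has infinitely many coordinates, so membership in the n-dimensional
  space is a predicate; its set argument also yields the coordinate subspaces used for
  irreducibility.\<close>

definition supported :: "nat set \<Rightarrow> vec \<Rightarrow> bool" where
  "supported I x \<longleftrightarrow> (\<forall>j. j \<notin> I \<longrightarrow> x j = 0)"

definition coroot :: "nat \<Rightarrow> vec \<Rightarrow> real" where
  "coroot i x = (\<Sum>j<n. a i j * x j)"

text \<open>Twice the usual bilinear form: roots have norm \<open>2\<close>.\<close>

definition form :: "vec \<Rightarrow> vec \<Rightarrow> real" where
  "form x y = (\<Sum>i<n. x i * coroot i y)"

definition reflect :: "nat \<Rightarrow> vec \<Rightarrow> vec" where
  "reflect i x = x(i := x i - coroot i x)"

definition act :: "nat list \<Rightarrow> vec \<Rightarrow> vec" where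
  "act ks x = foldr reflect ks x"

lemma act_Nil [simp]: "act [] x = x"
  and act_Cons [simp]: "act (k # ks) x = reflect k (act ks x)"
  and act_append [simp]: "act (ks @ ls) x = act ks (act ls x)"
  by (simp_all add: act_def)

lemma sum_bvec [simp]:
  "i < n \<Longrightarrow> (\<Sum>j<n. f j * bvec i j) = f i"
  "i < n \<Longrightarrow> (\<Sum>j<n. bvec i j * f j) = f i"
  by (simp_all add: bvec_def if_distrib[of "\<lambda>x. _ * x"] if_distrib[of "\<lambda>x. x * _"] cong: if_cong)

lemma coroot_bvec [simp]: "i < n \<Longrightarrow> coroot k (bvec i) = a k i"
  by (simp add: coroot_def)

lemma form_bvec_left [simp]: "i < n \<Longrightarrow> form (bvec i) y = coroot i y"
  by (simp add: form_def)

lemma form_commute: "form x y = form y x"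
proof -
  have "form x y = (\<Sum>i<n. \<Sum>j<n. x i * a i j * y j)"
    by (simp add: form_def coroot_def sum_distrib_left mult.assoc)
  also have "\<dots> = (\<Sum>j<n. \<Sum>i<n. x i * a i j * y j)"
    by (rule sum.swap)
  also have "\<dots> = (\<Sum>j<n. \<Sum>i<n. y j * (a j i * x i))"
    by (intro sum.cong HOL.refl) (simp add: symm)
  also have "\<dots> = form y x"
    by (simp add: form_def coroot_def sum_distrib_left)
  finally show ?thesis .
qed

lemma coroot_add: "coroot i (\<lambda>j. x j + y j) = coroot i x + coroot i y"
  and coroot_scale: "coroot i (\<lambda>j. q * x j) = q * coroot i x"
  by (simp_all add: coroot_def sum.distrib sum_distrib_left algebra_simps)

lemma reflect_add: "reflect i (\<lambda>j. x j + y j) = (\<lambda>j. reflect i x j + reflect i y j)"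
  and reflect_scale: "reflect i (\<lambda>j. q * x j) = (\<lambda>j. q * reflect i x j)"
  by (auto simp: reflect_def fun_eq_iff coroot_add coroot_scale algebra_simps)

lemma act_add: "act ks (\<lambda>j. x j + y j) = (\<lambda>j. act ks x j + act ks y j)"
  by (induction ks) (simp_all add: reflect_add)

lemma act_scale: "act ks (\<lambda>j. q * x j) = (\<lambda>j. q * act ks x j)"
  by (induction ks) (simp_all add: reflect_scale)

lemma act_minus: "act ks (\<lambda>j. - x j) = (\<lambda>j. - act ks x j)"
  using act_scale[of ks "-1" x] by simp

lemma act_diff: "act ks (\<lambda>j. x j - y j) = (\<lambda>j. act ks x j - act ks y j)"
  using act_add[of ks x "\<lambda>j. - y j"] by (simp add: act_minus)

lemma act_zero: "act ks (\<lambda>j. 0) = (\<lambda>j. 0)"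
  using act_scale[of ks 0 "\<lambda>j. 0"] by simp

lemma act_sum:
  assumes "finite A"
  shows "act ks (\<lambda>j. \<Sum>l\<in>A. p l * v l j) = (\<lambda>j. \<Sum>l\<in>A. p l * act ks (v l) j)"
  using assms by (induction A rule: finite_induct) (simp_all add: act_add act_scale act_zero)

lemma form_add_right: "form x (\<lambda>j. y j + z j) = form x y + form x z"
  and form_scale_right: "form x (\<lambda>j. q * y j) = q * form x y"
  by (simp_all add: form_def coroot_add coroot_scale sum.distrib sum_distrib_left algebra_simps)

lemma form_add_left: "form (\<lambda>j. x j + y j) z = form x z + form y z"
  and form_scale_left: "form (\<lambda>j. q * x j) z = q * form x z"
  by (simp_all add: form_def sum.distrib sum_distrib_left algebra_simps)

lemma form_diff_left: "form (\<lambda>j. x j - y j) z = form x z - form y z"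
  using form_add_left[of x "\<lambda>j. -1 * y j" z] form_scale_left[of "-1" y z] by simp

lemma reflect_eq: "reflect i x = (\<lambda>j. x j - coroot i x * bvec i j)"
  by (auto simp: reflect_def bvec_def fun_eq_iff)

lemma reflect_invol [simp]:
  assumes "i < n" shows "reflect i (reflect i x) = x"
proof -
  have "coroot i (reflect i x) = - coroot i x"
    using coroot_add[of i x "\<lambda>j. - coroot i x * bvec i j"] coroot_scale[of i "- coroot i x" "bvec i"] assms
    by (simp add: reflect_eq diag)
  then show ?thesis
    by (auto simp: reflect_def fun_eq_iff)
qed

lemma act_rev_act [simp]:
  assumes "set ks \<subseteq> {..<n}"
  shows "act (rev ks) (act ks x) = x" "act ks (act (rev ks) x) = x"
proof -
  have 1: "act (rev ks) (act ks x) = x" if "set ks \<subseteq> {..<n}" for ks x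
    using that by (induction ks) auto
  show "act (rev ks) (act ks x) = x"
    using assms by (rule 1)
  show "act ks (act (rev ks) x) = x"
    using 1[of "rev ks"] assms by simp
qed

lemma form_reflect [simp]:
  assumes "i < n" shows "form (reflect i x) (reflect i y) = form x y"
proof -
  have *: "reflect i z = (\<lambda>j. z j + (- coroot i z) * bvec i j)" for z
    by (simp add: reflect_eq)
  have "form x (bvec i) = coroot i x" for x
    using form_commute[of x] assms by simp
  then show ?thesis
    unfolding * form_add_left form_add_right form_scale_left form_scale_right
    using assms by (simp add: diag algebra_simps)
qed

lemma form_act [simp]: "set ks \<subseteq> {..<n} \<Longrightarrow> form (act ks x) (act ks y) = form x y"
  by (induction ks) auto

lemma form_act_left: "set ks \<subseteq> {..<n} \<Longrightarrow> form (act ks x) y = form x (act (rev ks) y)"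
  by (metis act_rev_act(2) form_act)

lemma act_other: "j \<notin> set ks \<Longrightarrow> act ks x j = x j"
  by (induction ks) (auto simp: reflect_def)

lemma supported_act: "set ks \<subseteq> I \<Longrightarrow> supported I x \<Longrightarrow> supported I (act ks x)"
  unfolding supported_def using act_other by (metis subsetD)

lemma supported_bvec: "i \<in> I \<Longrightarrow> supported I (bvec i)"
  by (auto simp: supported_def bvec_def)

lemma expand:
  "supported {..<n} x \<Longrightarrow> x = (\<lambda>j. \<Sum>i<n. x i * bvec i j)"
  by (rule ext) (auto simp: supported_def bvec_def if_distrib[of "\<lambda>x. _ * x"] cong: if_cong)

lemma act_conj_reflect:
  assumes "set vs \<subseteq> {..<n}" "l < n" "i < n" "act vs (bvec l) = bvec i"
  shows "act vs (reflect l x) = reflect i (act vs x)"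
proof -
  have "coroot l x = coroot i (act vs x)"
    using assms form_act[of vs "bvec l" x] by simp
  then show ?thesis
    using assms by (simp add: reflect_eq act_diff act_scale)
qed

section \<open>Roots and their signs\<close>

definition roots :: "vec set" where
  "roots = {act ks (bvec i) | ks i. set ks \<subseteq> {..<n} \<and> i < n}"

lemma rootsI: "set ks \<subseteq> {..<n} \<Longrightarrow> i < n \<Longrightarrow> act ks (bvec i) \<in> roots"
  by (auto simp: roots_def)

lemma bvec_root: "i < n \<Longrightarrow> bvec i \<in> roots"
  using rootsI[of "[]"] by simp

lemma act_root: "x \<in> roots \<Longrightarrow> set ks \<subseteq> {..<n} \<Longrightarrow> act ks x \<in> roots"
  unfolding roots_def by clarsimp (metis act_append set_append Un_subset_iff)

lemma root_uminus: "x \<in> roots \<Longrightarrow> (\<lambda>j. - x j) \<in> roots"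
proof -
  assume "x \<in> roots"
  then obtain ks i where x: "x = act ks (bvec i)" "set ks \<subseteq> {..<n}" "i < n"
    by (auto simp: roots_def)
  have "act (ks @ [i]) (bvec i) = (\<lambda>j. - x j)"
  proof -
    have "reflect i (bvec i) = (\<lambda>j. - bvec i j)"
      using x by (simp add: reflect_eq diag)
    then show ?thesis by (simp add: x act_minus)
  qed
  then show ?thesis
    using rootsI[of "ks @ [i]" i] x by simp
qed

lemma root_supported: "x \<in> roots \<Longrightarrow> supported {..<n} x"
  by (auto simp: roots_def intro!: supported_act supported_bvec)

lemma root_norm: "x \<in> roots \<Longrightarrow> form x x = 2"
  by (auto simp: roots_def diag)

lemma root_sign_unique: "x \<in> roots \<Longrightarrow> nonneg x \<Longrightarrow> nonpos x \<Longrightarrow> False"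
proof -
  assume "x \<in> roots" "nonneg x" "nonpos x"
  then have "x = (\<lambda>j. 0)" by (auto simp: nonneg_def nonpos_def fun_eq_iff antisym)
  then have "form x x = 0" by (simp add: form_def)
  with root_norm[OF \<open>x \<in> roots\<close>] show False by simp
qed

text \<open>A simple reflection changes only its own coordinate, so all other coordinates of
  \<open>x\<close> are both nonnegative and nonpositive. The norm \<open>2\<close> then forces
  \<open>x i = 1\<close>.\<close>

lemma simple_inversion:
  assumes "x \<in> roots" "i < n" "nonneg x" "nonpos (reflect i x)"
  shows "x = bvec i"
proof -
  have z: "x j = 0" if "j \<noteq> i" for j
    using that assms unfolding nonneg_def nonpos_def reflect_def
    by (metis fun_upd_apply antisym)
  then have x: "x = (\<lambda>j. x i * bvec i j)"
    by (auto simp: bvec_def fun_eq_iff)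
  have "x i * (x i * 2) = 2"
    using root_norm[OF assms(1)] form_scale_left[of "x i" "bvec i"] form_scale_right[of _ "x i" "bvec i"]
      x assms(2) by (metis coroot_bvec diag form_bvec_left)
  then have "x i ^ 2 = 1" by (simp add: power2_eq_square)
  then have "x i = 1"
    using assms(3) by (auto simp: nonneg_def power2_eq_1_iff) (metis neg_0_le_iff_le not_one_le_zero)
  with x show ?thesis by simp
qed

lemma nonneg_bvec: "nonneg (bvec i)"
  by (simp add: nonneg_def bvec_def)

lemma nonneg_uminus [simp]: "nonneg (\<lambda>j. - x j) = nonpos x" "nonpos (\<lambda>j. - x j) = nonneg x"
  by (simp_all add: nonneg_def nonpos_def)

end

section \<open>The Euler form of a Coxeter element\<close>

context cartan_matrix
begin

definition beta :: "nat \<Rightarrow> vec" where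
  "beta i = act [0..<i] (bvec i)"

text \<open>The lower triangle of \<open>a\<close> with half of the diagonal: adding the transpose
  gives back \<open>a\<close>.\<close>

definition euler_entry :: "nat \<Rightarrow> nat \<Rightarrow> real" where
  "euler_entry i k = (if k = i then 1 else if k < i then a i k else 0)"

definition euler :: "vec \<Rightarrow> vec \<Rightarrow> real" where
  "euler x y = (\<Sum>i<n. \<Sum>k<n. x i * euler_entry i k * y k)"

text \<open>Powers are kept as words so that every fact about \<open>act\<close> applies to them;
  reversal inverts because the letters act as involutions.\<close>

definition cox_word :: "int \<Rightarrow> nat list" where
  "cox_word k = (if 0 \<le> k then concat (replicate (nat k) [0..<n])
     else concat (replicate (nat (- k)) (rev [0..<n])))"

definition cox :: "int \<Rightarrow> vec \<Rightarrow> vec" where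
  "cox k x = act (cox_word k) x"

lemma set_cox_word: "set (cox_word k) \<subseteq> {..<n}"
  by (auto simp: cox_word_def)

lemma cox_0 [simp]: "cox 0 x = x"
  and cox_1: "cox 1 x = act [0..<n] x"
  and cox_m1: "cox (- 1) x = act (rev [0..<n]) x"
  by (simp_all add: cox_def cox_word_def)

lemma cox_Suc: "cox (k + 1) x = cox 1 (cox k x)"
proof (cases "0 \<le> k")
  case True
  then have "nat (k + 1) = Suc (nat k)" by simp
  with True show ?thesis by (simp add: cox_def cox_word_def)
next
  case False
  then have "nat (- k) = Suc (nat (- (k + 1)))" by simp
  then have "cox_word k = rev [0..<n] @ cox_word (k + 1)"
    using False by (auto simp: cox_word_def)
  then have "cox k x = cox (- 1) (cox (k + 1) x)"
    unfolding cox_m1 by (simp add: cox_def)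
  then have "cox 1 (cox k x) = act [0..<n] (act (rev [0..<n]) (cox (k + 1) x))"
    by (simp add: cox_1 cox_m1)
  moreover have "set [0..<n] \<subseteq> {..<n}" by auto
  ultimately show ?thesis
    by (metis act_rev_act(2))
qed

lemma cox_add: "cox (k + l) x = cox k (cox l x)"
proof (induction k rule: int_induct[where k = 0])
  case base
  then show ?case by simp
next
  case (step1 i)
  have "cox (i + 1 + l) x = cox 1 (cox (i + l) x)"
    using cox_Suc[of "i + l" x] by (simp add: algebra_simps)
  then show ?case using step1 cox_Suc[of i "cox l x"] by simp
next
  case (step2 i)
  have inj: "u = v" if "cox 1 u = cox 1 v" for u v
  proof -
    have "set [0..<n] \<subseteq> {..<n}" by auto
    then show ?thesis using that act_rev_act(1) unfolding cox_1 by metis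
  qed
  have "cox 1 (cox (i - 1 + l) x) = cox 1 (cox (i - 1) (cox l x))"
    using cox_Suc[of "i - 1 + l" x] cox_Suc[of "i - 1" "cox l x"] step2
    by (simp add: algebra_simps)
  then show ?case by (rule inj)
qed

lemma cox_cancel [simp]: "cox k (cox (- k) x) = x" "cox (- k) (cox k x) = x"
  using cox_add[of k "- k" x] cox_add[of "- k" k x] by simp_all

lemma cox_inj: "cox k x = cox k y \<Longrightarrow> x = y"
  by (metis cox_cancel(2))

lemma cox_minus: "cox k (\<lambda>j. - x j) = (\<lambda>j. - cox k x j)"
  by (simp add: cox_def act_minus)

lemma cox_root: "x \<in> roots \<Longrightarrow> cox k x \<in> roots"
  by (simp add: cox_def act_root set_cox_word)

lemma form_cox [simp]: "form (cox k x) (cox k y) = form x y"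
  by (simp add: cox_def set_cox_word)

lemma beta_root: "i < n \<Longrightarrow> beta i \<in> roots"
  by (auto simp: beta_def intro!: rootsI)

lemma beta_diag: "beta i i = 1"
  by (simp add: beta_def act_other) (simp add: bvec_def)

lemma beta_upper: "i < j \<Longrightarrow> beta i j = 0"
  by (simp add: beta_def act_other) (simp add: bvec_def)

lemma beta_supported: "i < n \<Longrightarrow> supported {..<n} (beta i)"
  by (simp add: beta_root root_supported)

text \<open>The last reflection subtracts a multiple of a simple root, and the prefix still to be
  applied carries that simple root to \<open>beta k\<close>.\<close>

lemma act_upt_telescope:
  "k \<le> n \<Longrightarrow> act [0..<k] x = (\<lambda>j. x j - (\<Sum>l<k. coroot l x * beta l j))"
proof (induction k arbitrary: x)
  case 0
  then show ?case by simp
next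
  case (Suc k)
  have "act [0..<Suc k] x = act [0..<k] (\<lambda>j. x j - coroot k x * bvec k j)"
    by (simp add: reflect_eq)
  also have "\<dots> = (\<lambda>j. act [0..<k] x j - coroot k x * beta k j)"
    by (simp add: act_diff act_scale beta_def)
  finally show ?case
    using Suc by (auto simp: fun_eq_iff)
qed

lemma bvec_beta:
  assumes "i < n"
  shows "bvec i = (\<lambda>j. \<Sum>k<n. euler_entry i k * beta k j)"
proof
  fix j
  have "bvec i j = beta i j + (\<Sum>k<i. a i k * beta k j)"
    using act_upt_telescope[of i "bvec i"] assms
    by (simp add: beta_def symm fun_eq_iff)
  also have "\<dots> = (\<Sum>k\<in>insert i {..<i}. euler_entry i k * beta k j)"
    by (simp add: euler_entry_def)
  also have "\<dots> = (\<Sum>k<n. euler_entry i k * beta k j)"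
    by (rule sum.mono_neutral_left) (use assms in \<open>auto simp: euler_entry_def\<close>)
  finally show "bvec i j = (\<Sum>k<n. euler_entry i k * beta k j)" .
qed

lemma beta_expand:
  assumes "supported {..<n} x"
  shows "x = (\<lambda>j. \<Sum>k<n. (\<Sum>i<n. x i * euler_entry i k) * beta k j)"
proof
  fix j
  have "x j = (\<Sum>i<n. x i * bvec i j)"
    using expand[OF assms] by metis
  also have "\<dots> = (\<Sum>i<n. \<Sum>k<n. x i * (euler_entry i k * beta k j))"
    by (intro sum.cong HOL.refl) (simp add: bvec_beta sum_distrib_left)
  also have "\<dots> = (\<Sum>k<n. \<Sum>i<n. x i * (euler_entry i k * beta k j))"
    by (rule sum.swap)
  finally show "x j = (\<Sum>k<n. (\<Sum>i<n. x i * euler_entry i k) * beta k j)"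
    by (simp add: sum_distrib_right mult.assoc)
qed

lemma euler_add_left: "euler (\<lambda>j. x j + y j) z = euler x z + euler y z"
  and euler_diff_left: "euler (\<lambda>j. x j - y j) z = euler x z - euler y z"
  and euler_scale_left: "euler (\<lambda>j. q * x j) z = q * euler x z"
  and euler_minus_left: "euler (\<lambda>j. - x j) z = - euler x z"
  and euler_add_right: "euler x (\<lambda>j. y j + z j) = euler x y + euler x z"
  and euler_scale_right: "euler x (\<lambda>j. q * y j) = q * euler x y"
  by (simp_all add: euler_def sum.distrib sum_subtractf sum_distrib_left sum_negf algebra_simps)

lemma euler_sum_left:
  "finite A \<Longrightarrow> euler (\<lambda>j. \<Sum>l\<in>A. p l * v l j) y = (\<Sum>l\<in>A. p l * euler (v l) y)"
proof (induction A rule: finite_induct)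
  case empty
  then show ?case by (simp add: euler_def)
qed (simp add: euler_add_left euler_scale_left)

lemma euler_sum_right:
  "finite A \<Longrightarrow> euler y (\<lambda>j. \<Sum>l\<in>A. p l * v l j) = (\<Sum>l\<in>A. p l * euler y (v l))"
proof (induction A rule: finite_induct)
  case empty
  then show ?case by (simp add: euler_def)
qed (simp add: euler_add_right euler_scale_right)

lemma euler_bvec:
  assumes "i < n"
  shows "euler (bvec i) y = (\<Sum>k<n. euler_entry i k * y k)"
proof -
  have "euler (bvec i) y = (\<Sum>l<n. bvec i l * (\<Sum>k<n. euler_entry l k * y k))"
    by (simp add: euler_def sum_distrib_left mult.assoc)
  then show ?thesis using assms by simp
qed

text \<open>The roots \<^term>\<open>beta i\<close> play the role of the indecomposable projectives of a
  hereditary algebra: their Euler pairing reads off coordinates.\<close>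

lemma euler_beta:
  assumes "i < n"
  shows "euler (beta i) y = y i"
  using assms
proof (induction i rule: less_induct)
  case (less i)
  have "beta i = (\<lambda>j. bvec i j - (\<Sum>k<i. a i k * beta k j))"
    using act_upt_telescope[of i "bvec i"] less.prems
    by (simp add: beta_def symm fun_eq_iff)
  then have "euler (beta i) y = euler (bvec i) y - (\<Sum>k<i. a i k * y k)"
    using less by (simp add: euler_diff_left euler_sum_left)
  moreover have "euler (bvec i) y = (\<Sum>k\<in>insert i {..<i}. euler_entry i k * y k)"
    unfolding euler_bvec[OF less.prems]
    by (rule sum.mono_neutral_right) (use less.prems in \<open>auto simp: euler_entry_def\<close>)
  ultimately show ?case
    by (simp add: euler_entry_def)
qed

lemma euler_symmetrize: "euler x y + euler y x = form x y"
proof -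
  have "euler y x = (\<Sum>k<n. \<Sum>i<n. y i * euler_entry i k * x k)"
    unfolding euler_def by (rule sum.swap)
  then have "euler x y + euler y x =
      (\<Sum>i<n. \<Sum>k<n. x i * (euler_entry i k + euler_entry k i) * y k)"
    by (simp add: euler_def sum.distrib algebra_simps)
  also have "\<dots> = (\<Sum>i<n. \<Sum>k<n. x i * a i k * y k)"
  proof (intro sum.cong HOL.refl)
    fix i k assume "i \<in> {..<n}" "k \<in> {..<n}"
    then have "euler_entry i k + euler_entry k i = a i k"
      by (auto simp: euler_entry_def diag symm)
    then show "x i * (euler_entry i k + euler_entry k i) * y k = x i * a i k * y k" by simp
  qed
  also have "\<dots> = form x y"
    by (simp add: form_def coroot_def sum_distrib_left mult.assoc)
  finally show ?thesis .
qed

lemma cox_1_eq: "cox 1 x = (\<lambda>j. x j - (\<Sum>l<n. coroot l x * beta l j))"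
  by (simp add: cox_1 act_upt_telescope)

text \<open>By telescoping, \<open>x - cox 1 x\<close> is the combination of the
  \<open>beta l\<close> with coefficients \<open>coroot l x\<close>. Its Euler pairing with
  \<open>y\<close> is \<open>form x y\<close> by \<open>euler_beta\<close>, and symmetrization does
  the rest.\<close>

lemma euler_cox_left: "euler (cox 1 x) y = - euler y x"
proof -
  have "euler (cox 1 x) y = euler x y - form x y"
    by (subst form_commute)
      (simp add: cox_1_eq euler_diff_left euler_sum_left euler_beta form_def, simp add: mult.commute)
  then show ?thesis using euler_symmetrize[of x y] by simp
qed

lemma form_eq_euler: "form x y = euler x y - euler (cox 1 x) y"
  using euler_cox_left euler_symmetrize by simp

lemma euler_cox_right: "euler x y = - euler y (cox (- 1) x)"
  using euler_cox_left[of "cox (- 1) x" y] cox_cancel(1)[of 1 x] by simp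

lemma euler_cox_1: "euler (cox 1 x) (cox 1 y) = euler x y"
  by (simp add: euler_cox_left)

lemma euler_cox [simp]: "euler (cox k x) (cox k y) = euler x y"
proof (induction k rule: int_induct[where k = 0])
  case (step1 i)
  then show ?case by (simp add: cox_Suc euler_cox_1)
next
  case (step2 i)
  then show ?case
    using euler_cox_1[of "cox (i - 1) x" "cox (i - 1) y"] cox_Suc[of "i - 1"] by simp
qed simp

lemma euler_shift: "euler x (cox k y) = euler (cox l x) (cox (k + l) y)"
  using euler_cox[of l x "cox k y"] by (simp add: cox_add[symmetric] add.commute)

text \<open>An analogue of Serre duality: coordinates are Euler pairings with a \<open>beta\<close>,
  and swapping the arguments costs a sign and one inverse Coxeter element. It turns positivity for
  \<open>k >= 0\<close> into negativity for \<open>k < 0\<close>.\<close>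

lemma cox_coord_dual:
  assumes "i < n" "j < n"
  shows "cox k (beta j) i = - cox (- 1 - k) (beta i) j"
proof -
  have "cox k (beta j) i = euler (beta i) (cox k (beta j))"
    using assms by (simp add: euler_beta)
  also have "\<dots> = - euler (cox k (beta j)) (cox (- 1) (beta i))"
    by (rule euler_cox_right)
  also have "\<dots> = - euler (beta j) (cox (- 1 - k) (beta i))"
    using euler_shift[of "cox k (beta j)" "-1" "beta i" "-k"] by simp
  finally show ?thesis using assms by (simp add: euler_beta)
qed

text \<open>Take the largest index \<open>m\<close> outside \<open>I\<close> with nonzero
  coefficient. At coordinate \<open>m\<close> the \<open>beta l\<close> with \<open>l\<close> in
  \<open>I\<close> vanish by support and those with \<open>l < m\<close> by triangularity, so only
  \<open>p m\<close> survives.\<close>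

lemma combination_supported:
  assumes I: "I \<subseteq> {..<n}" "\<forall>i\<in>I. supported I (beta i)"
    and x: "supported I (\<lambda>j. \<Sum>k<n. p k * beta k j)"
    and k: "k < n" "k \<notin> I"
  shows "p k = 0"
proof (rule ccontr)
  assume nz: "p k \<noteq> 0"
  define K where "K = {k. k < n \<and> k \<notin> I \<and> p k \<noteq> 0}"
  have K: "finite K" "K \<noteq> {}" using k nz by (auto simp: K_def)
  define m where "m = Max K"
  have m: "m < n" "m \<notin> I" "p m \<noteq> 0"
    using Max_in[OF K] by (auto simp: m_def K_def)
  have max: "p l = 0" if "l < n" "l \<notin> I" "m < l" for l
  proof (rule ccontr)
    assume "p l \<noteq> 0"
    then have "l \<in> K" using that by (simp add: K_def)
    then show False using Max_ge[OF K(1)] that(3) unfolding m_def by (meson leD)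
  qed
  have "p l * beta l m = 0" if "l < n" "l \<noteq> m" for l
  proof (cases "l \<in> I")
    case True
    then show ?thesis using I(2) m by (auto simp: supported_def)
  next
    case False
    then show ?thesis using max[of l] that beta_upper[of l m] by (cases "l < m") auto
  qed
  then have "(\<Sum>l<n. p l * beta l m) = (\<Sum>l\<in>{m}. p l * beta l m)"
    by (intro sum.mono_neutral_right) (use m in auto)
  moreover have "(\<Sum>l<n. p l * beta l m) = 0"
    using x m by (auto simp: supported_def)
  ultimately show False using m by (simp add: beta_diag)
qed

text \<open>Both \<open>x - c x\<close> and the simple roots have explicit expansions in the basis \<^term>\<open>beta\<close>;
  triangularity kills the coefficients outside \<open>I\<close>.\<close>

lemma stable_support_decouples:
  assumes I: "I \<subseteq> {..<n}"
    and b: "\<forall>i\<in>I. supported I (beta i)"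
    and c: "\<forall>i\<in>I. supported I (cox 1 (beta i))"
    and ij: "i \<in> I" "j < n" "j \<notin> I"
  shows "a i j = 0"
proof -
  have 1: "coroot k (beta l) = 0" if "l \<in> I" "k < n" "k \<notin> I" for k l
  proof (rule combination_supported[OF I b, where p = "\<lambda>k. coroot k (beta l)"])
    show "supported I (\<lambda>j. \<Sum>k<n. coroot k (beta l) * beta k j)"
      using b c that by (auto simp: supported_def cox_1_eq)
  qed (use that in auto)
  have 2: "euler_entry i k = 0" if "k < n" "k \<notin> I" for k
  proof (rule combination_supported[OF I b _ that, where p = "euler_entry i"])
    show "supported I (\<lambda>j. \<Sum>k<n. euler_entry i k * beta k j)"
      using bvec_beta[of i] supported_bvec[of i I] ij I by auto
  qed
  have "i < n" using ij I by auto
  have "form (bvec j) (bvec i) = (\<Sum>k<n. euler_entry i k * form (bvec j) (beta k))"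
  proof -
    have *: "form z (\<lambda>j. \<Sum>k\<in>A. p k * beta k j) = (\<Sum>k\<in>A. p k * form z (beta k))"
      if "finite A" for z p A
      using that
    proof (induction A rule: finite_induct)
      case empty
      then show ?case by (simp add: form_def coroot_def)
    qed (simp add: form_add_right form_scale_right)
    show ?thesis
      by (subst bvec_beta[OF \<open>i < n\<close>]) (simp add: *)
  qed
  also have "\<dots> = 0"
  proof (intro sum.neutral ballI)
    fix k assume "k \<in> {..<n}"
    then show "euler_entry i k * form (bvec j) (beta k) = 0"
      using 1[of k j] 2[of k] ij by (cases "k \<in> I") auto
  qed
  finally show ?thesis using \<open>i < n\<close> ij by (simp add: symm)
qed

end

section \<open>Powers of Coxeter elements\<close>

text \<open>What the centralizer argument takes from the Coxeter group; verified for the geometric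
  representation in \<open>centralizer_standard\<close>.\<close>

locale infinite_coxeter_roots = cartan_matrix +
  assumes root_sign: "x \<in> roots \<Longrightarrow> nonneg x \<or> nonpos x"
    and infinite_roots: "infinite roots"
    and connected: "I \<subseteq> {..<n} \<Longrightarrow> (\<And>i j. i \<in> I \<Longrightarrow> j < n \<Longrightarrow> j \<notin> I \<Longrightarrow> a i j = 0) \<Longrightarrow>
      I = {} \<or> I = {..<n}"
begin

text \<open>Some letter of \<open>ks\<close> turns a positive root into a negative one; by
  \<open>simple_inversion\<close> that root is the simple root of the letter.\<close>

lemma inversion_split:
  assumes "x \<in> roots" "nonneg x" "set ks \<subseteq> {..<n}" "nonpos (act ks x)"
  shows "\<exists>us i vs. ks = us @ i # vs \<and> act vs x = bvec i"
  using assms(3,4)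
proof (induction ks)
  case Nil
  then show ?case using assms root_sign_unique by auto
next
  case (Cons k ks)
  show ?case
  proof (cases "nonneg (act ks x)")
    case True
    then have "act ks x = bvec k"
      using simple_inversion[of "act ks x" k] Cons.prems act_root[OF assms(1), of ks] by simp
    then show ?thesis by (intro exI[of _ "[]"]) auto
  next
    case False
    then have "nonpos (act ks x)"
      using root_sign[OF act_root[OF assms(1), of ks]] Cons.prems by auto
    then obtain us i vs where "ks = us @ i # vs" "act vs x = bvec i"
      using Cons by auto
    then show ?thesis by (intro exI[of _ "k # us"]) auto
  qed
qed

lemma inversion_index:
  assumes "x \<in> roots" "nonneg x" "set ks \<subseteq> {..<n}" "nonpos (act ks x)"
  shows "\<exists>m<length ks. x = act (rev (drop (Suc m) ks)) (bvec (ks ! m))"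
proof -
  obtain us i vs where ks: "ks = us @ i # vs" "act vs x = bvec i"
    using inversion_split[OF assms] by blast
  then have "x = act (rev vs) (bvec i)"
    using act_rev_act(1)[of vs x] assms(3) by simp
  with ks show ?thesis
    by (intro exI[of _ "length us"]) simp
qed

lemma finite_inversions:
  assumes "set ks \<subseteq> {..<n}"
  shows "finite {x \<in> roots. nonneg x \<and> nonpos (act ks x)}"
proof (rule finite_subset)
  show "{x \<in> roots. nonneg x \<and> nonpos (act ks x)} \<subseteq>
      (\<lambda>m. act (rev (drop (Suc m) ks)) (bvec (ks ! m))) ` {..<length ks}"
    using inversion_index[OF _ _ assms] by blast
qed simp

text \<open>In \<open>rev [0..<n]\<close> the letters right of position \<open>m\<close>, reversed,
  form \<open>[0..<n - Suc m]\<close>, so the roots given by \<open>inversion_index\<close> are the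
  \<open>beta i\<close>.\<close>

lemma cox_inversion:
  assumes "x \<in> roots" "nonneg x" "nonpos (cox (- 1) x)"
  shows "\<exists>i<n. x = beta i"
proof -
  have "set (rev [0..<n]) \<subseteq> {..<n}" by auto
  then obtain m where m: "m < n" "x = act (rev (drop (Suc m) (rev [0..<n]))) (bvec (rev [0..<n] ! m))"
    using inversion_index[OF assms(1,2), of "rev [0..<n]"] assms(3) by (auto simp: cox_m1)
  then have "x = beta (n - Suc m)"
    by (simp add: beta_def drop_rev rev_nth)
  with m show ?thesis by (intro exI[of _ "n - Suc m"]) auto
qed

lemma nonneg_beta: "i < n \<Longrightarrow> nonneg (beta i)"
  using root_sign[OF beta_root] beta_diag[of i] unfolding nonpos_def
  by (metis not_one_le_zero)

lemma nonpos_cox_m1_beta: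
  assumes "j < n" shows "nonpos (cox (- 1) (beta j))"
  unfolding nonpos_def
proof
  fix i
  show "cox (- 1) (beta j) i \<le> 0"
  proof (cases "i < n")
    case True
    then show ?thesis
      using cox_coord_dual[of i j "-1"] nonneg_beta[of i] assms by (simp add: nonneg_def)
  next
    case False
    then show ?thesis
      using root_supported[OF cox_root[OF beta_root[OF assms]], of "-1"] by (simp add: supported_def)
  qed
qed

lemma beta_inj: "beta i = beta j \<Longrightarrow> i = j"
  by (metis beta_diag beta_upper linorder_neqE_nat zero_neq_one)

text \<open>At the first exponent \<open>d\<close> where positivity fails, the negative of the
  vector is a positive root that \<open>cox (- 1)\<close> makes negative, so
  \<open>cox_inversion\<close> identifies it.\<close>

lemma cox_beta_turn:
  assumes "j < n" "\<not> nonneg (cox (int k) (beta j))"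
  shows "\<exists>d i. i < n \<and> 0 < d \<and> cox (int d) (beta j) = (\<lambda>l. - beta i l) \<and>
    (\<forall>k<d. nonneg (cox (int k) (beta j)))"
proof -
  define d where "d = (LEAST k. \<not> nonneg (cox (int k) (beta j)))"
  have d: "\<not> nonneg (cox (int d) (beta j))"
    unfolding d_def using assms(2) by (rule LeastI)
  have least: "nonneg (cox (int k) (beta j))" if "k < d" for k
    using not_less_Least[of k] that unfolding d_def by blast
  have "d \<noteq> 0" using d nonneg_beta[OF assms(1)] by (intro notI) simp
  define x where "x = (\<lambda>l. - cox (int d) (beta j) l)"
  have root: "cox (int d) (beta j) \<in> roots" using assms by (simp add: cox_root beta_root)
  have x: "x \<in> roots" "nonneg x"
    using root d root_sign[OF root] root_uminus by (auto simp: x_def)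
  have "cox (- 1) x = (\<lambda>l. - cox (int (d - 1)) (beta j) l)"
    using \<open>d \<noteq> 0\<close> cox_add[of "-1" "int d" "beta j"] by (simp add: x_def cox_minus of_nat_diff)
  then have "nonpos (cox (- 1) x)"
    using least[of "d - 1"] \<open>d \<noteq> 0\<close> by simp
  then obtain i where "i < n" "x = beta i"
    using cox_inversion[OF x] by blast
  then have "cox (int d) (beta j) = (\<lambda>l. - beta i l)"
    unfolding x_def by (metis minus_minus)
  with \<open>i < n\<close> \<open>d \<noteq> 0\<close> least show ?thesis by blast
qed

text \<open>Speyer's theorem that powers of Coxeter elements are reduced. The set \<open>A\<close> of indices whose
  orbit eventually turns negative is a union of components, and if it were everything, each
  positive root would be an inversion of one of finitely many powers of the Coxeter element.\<close>

lemma nonneg_cox_beta: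
  assumes "j < n" shows "nonneg (cox (int k) (beta j))"
proof -
  define A where "A = {j. j < n \<and> (\<exists>k. \<not> nonneg (cox (int k) (beta j)))}"
  have "\<exists>d i. i < n \<and> 0 < d \<and> cox (int d) (beta j) = (\<lambda>l. - beta i l) \<and>
    (\<forall>k<d. nonneg (cox (int k) (beta j)))" if "j \<in> A" for j
    using that cox_beta_turn by (auto simp: A_def)
  then obtain d \<nu> where turn: "\<And>j. j \<in> A \<Longrightarrow> \<nu> j < n \<and> 0 < (d j :: nat) \<and>
      cox (int (d j)) (beta j) = (\<lambda>l. - beta (\<nu> j) l) \<and> (\<forall>k<d j. nonneg (cox (int k) (beta j)))"
    by metis
  define I where "I = {..<n} - A"
  have good: "nonneg (cox (int k) (beta i))" if "i \<in> I" for i k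
    using that by (auto simp: I_def A_def)
  \<comment> \<open>For \<open>j\<close> in \<open>A\<close>, shifting the pairing with
    \<open>beta j\<close> by \<open>d j\<close> replaces \<open>beta j\<close> by
    \<open>- beta (\<nu> j)\<close>. The coordinate thus equals minus a coordinate of a later vector
    of the orbit, and both vectors are nonnegative.\<close>
  have supp: "supported I (cox (int k) (beta i))" if i: "i \<in> I" for i k
    unfolding supported_def
  proof (intro allI impI)
    fix j assume "j \<notin> I"
    show "cox (int k) (beta i) j = 0"
    proof (cases "j < n")
      case False
      have "cox (int k) (beta i) \<in> roots" using i by (simp add: I_def beta_root cox_root)
      then show ?thesis using False root_supported by (auto simp: supported_def)
    next
      case True
      with \<open>j \<notin> I\<close> have j: "j \<in> A" by (simp add: I_def)
      have "cox (int k) (beta i) j = euler (beta j) (cox (int k) (beta i))"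
        using True by (simp add: euler_beta)
      also have "\<dots> = euler (cox (int (d j)) (beta j)) (cox (int k + int (d j)) (beta i))"
        by (rule euler_shift)
      also have "\<dots> = - cox (int (k + d j)) (beta i) (\<nu> j)"
        using turn[OF j] by (simp add: euler_minus_left euler_beta)
      finally show ?thesis
        using good[OF i, of k] good[OF i, of "k + d j"] unfolding nonneg_def
        by (metis antisym neg_le_0_iff_le)
    qed
  qed
  have "I = {} \<or> I = {..<n}"
  proof (rule connected)
    show "a i j = 0" if "i \<in> I" "j < n" "j \<notin> I" for i j
      using supp[of _ 0] supp[of _ 1] that
      by (intro stable_support_decouples[of I]) (auto simp: I_def)
  qed (auto simp: I_def)
  moreover have "I \<noteq> {}"
  proof
    assume "I = {}"
    then have A: "A = {..<n}" by (auto simp: I_def A_def)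
    \<comment> \<open>Orbits reaching the same negative \<open>beta\<close> at different times would
      identify the nonpositive \<open>cox (- 1) (beta i)\<close> with a nonnegative vector in the
      orbit of \<open>beta j\<close>.\<close>
    have inj_le: "i = j" if ij: "i < n" "j < n" "\<nu> i = \<nu> j" "d i \<le> d j" for i j
    proof (cases "d i = d j")
      case True
      have "cox (int (d i)) (beta i) = cox (int (d j)) (beta j)"
        using turn[of i] turn[of j] ij A by simp
      then show ?thesis using True cox_inj beta_inj by metis
    next
      case False
      then have e: "d i < d j" using ij by simp
      have "cox (int (d i)) (beta i) = cox (int (d j)) (beta j)"
        using turn[of i] turn[of j] ij A by simp
      then have "cox (- 1 - int (d i)) (cox (int (d i)) (beta i)) =
          cox (- 1 - int (d i)) (cox (int (d j)) (beta j))" by simp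
      then have "cox (- 1) (beta i) = cox (int (d j - d i - 1)) (beta j)"
        using e by (simp add: cox_add[symmetric] of_nat_diff algebra_simps)
      moreover have "nonneg (cox (int (d j - d i - 1)) (beta j))"
      proof -
        have "d j - d i - 1 < d j" using e by simp
        then show ?thesis using turn[of j] ij A by blast
      qed
      ultimately show ?thesis
        using nonpos_cox_m1_beta[of i] root_sign_unique cox_root beta_root ij by metis
    qed
    have "inj_on \<nu> {..<n}"
      by (intro inj_onI) (metis inj_le lessThan_iff nat_le_linear)
    then have surj: "\<nu> ` {..<n} = {..<n}"
      using turn A by (intro endo_inj_surj) auto
    \<comment> \<open>Since \<nu> is onto, a positive coordinate of \<open>x\<close> has an index
      \<open>\<nu> i\<close>; going back \<open>d i\<close> steps makes coordinate \<open>i\<close>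
      negative, so \<open>x\<close> is an inversion of one of \<open>n\<close> fixed words.\<close>
    have "{x \<in> roots. nonneg x} \<subseteq>
        (\<Union>i<n. {x \<in> roots. nonneg x \<and> nonpos (act (cox_word (- int (d i))) x)})"
    proof clarify
      fix x assume x: "x \<in> roots" "nonneg x"
      have "\<exists>i'. 0 < x i'"
        using root_sign_unique[OF x] unfolding nonpos_def by (meson not_le)
      then obtain i' where i': "0 < x i'" ..
      then have "i' < n" using root_supported[OF x(1)] unfolding supported_def by fastforce
      then obtain i where i: "i < n" "\<nu> i = i'" using surj by (metis imageE lessThan_iff)
      have "cox (- int (d i)) x i = euler (beta i) (cox (- int (d i)) x)"
        using i by (simp add: euler_beta)
      also have "\<dots> = euler (cox (int (d i)) (beta i)) x"
        using euler_shift[of "beta i" "- int (d i)" x "int (d i)"] by simp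
      also have "\<dots> = - x i'"
        using turn[of i] i A \<open>i' < n\<close> by (simp add: euler_minus_left euler_beta)
      finally have "\<not> nonneg (cox (- int (d i)) x)"
        using i' unfolding nonneg_def by (metis neg_0_le_iff_le not_le)
      then have "nonpos (act (cox_word (- int (d i))) x)"
        using root_sign[OF cox_root[OF x(1)]] by (auto simp: cox_def)
      then show "x \<in> (\<Union>i<n. {x \<in> roots. nonneg x \<and> nonpos (act (cox_word (- int (d i))) x)})"
        using x i by auto
    qed
    then have fin: "finite {x \<in> roots. nonneg x}"
      by (rule finite_subset) (simp add: finite_inversions set_cox_word)
    have "roots \<subseteq> {x \<in> roots. nonneg x} \<union> (\<lambda>x l. - x l) ` {x \<in> roots. nonneg x}"
    proof
      fix x assume x: "x \<in> roots"
      show "x \<in> {x \<in> roots. nonneg x} \<union> (\<lambda>x l. - x l) ` {x \<in> roots. nonneg x}"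
      proof (cases "nonneg x")
        case False
        then have "(\<lambda>l. - x l) \<in> {x \<in> roots. nonneg x}"
          using x root_sign root_uminus by auto
        then show ?thesis by (intro UnI2 image_eqI[of _ _ "\<lambda>l. - x l"]) auto
      qed (use x in auto)
    qed
    then show False
      using fin infinite_roots by (meson finite_Un finite_imageI finite_subset)
  qed
  ultimately show ?thesis
    using good assms by auto
qed

lemma nonpos_cox_beta:
  assumes "j < n" "k < 0" shows "nonpos (cox k (beta j))"
  unfolding nonpos_def
proof
  fix i
  show "cox k (beta j) i \<le> 0"
  proof (cases "i < n")
    case True
    then show ?thesis
      using cox_coord_dual[of i j k] nonneg_cox_beta[of i "nat (- 1 - k)"] assms
      by (simp add: nonneg_def)
  next
    case False
    then show ?thesis
      using root_supported[OF cox_root[OF beta_root[OF assms(1)]], of k] by (simp add: supported_def)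
  qed
qed

lemma nonneg_cox_beta_int: "j < n \<Longrightarrow> 0 \<le> k \<Longrightarrow> nonneg (cox k (beta j))"
  using nonneg_cox_beta[of j "nat k"] by simp

text \<open>If \<open>k < l\<close>, applying \<open>cox (- 1 - k)\<close> would identify the
  nonpositive \<open>cox (- 1) (beta i)\<close> with the nonnegative
  \<open>cox (l - k - 1) (beta j)\<close>. So the orbits are infinite and disjoint.\<close>

lemma cox_beta_eqD:
  assumes ij: "i < n" "j < n" and eq: "cox k (beta i) = cox l (beta j)"
  shows "k = l \<and> i = j"
proof -
  have le: "l \<le> k" if "i < n" "j < n" "cox k (beta i) = cox l (beta j)" for i j k l
  proof (rule ccontr)
    assume "\<not> l \<le> k"
    have "cox (- 1 - k) (cox k (beta i)) = cox (- 1 - k) (cox l (beta j))" using that by simp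
    then have "cox (- 1) (beta i) = cox (l - k - 1) (beta j)"
      by (simp add: cox_add[symmetric] algebra_simps)
    then show False
      using nonpos_cox_m1_beta[of i] nonneg_cox_beta_int[of j "l - k - 1"] \<open>\<not> l \<le> k\<close> that
        root_sign_unique[OF cox_root[OF beta_root[of j]]] by auto
  qed
  have "k = l" using le[OF ij eq] le[OF ij(2,1) eq[symmetric]] by simp
  then show ?thesis using eq cox_inj beta_inj by metis
qed

section \<open>Centralizing words and the orbits of the Coxeter element\<close>

definition centralizes :: "nat list \<Rightarrow> bool" where
  "centralizes ks \<longleftrightarrow> set ks \<subseteq> {..<n} \<and> (\<forall>x. act ks (cox 1 x) = cox 1 (act ks x))"

lemma centralizes_cox:
  assumes "centralizes ks" shows "act ks (cox k x) = cox k (act ks x)"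
proof (induction k rule: int_induct[where k = 0])
  case (step1 i)
  then show ?case using assms by (simp add: cox_Suc centralizes_def)
next
  case (step2 i)
  have "cox 1 (act ks (cox (i - 1) x)) = act ks (cox (i - 1 + 1) x)"
    using assms unfolding cox_Suc by (simp add: centralizes_def)
  also have "\<dots> = cox 1 (cox (i - 1) (act ks x))"
    using step2 cox_Suc[of "i - 1" "act ks x"] by simp
  finally show ?case by (rule cox_inj)
qed simp

text \<open>Applying \<open>ks\<close> to the orbit of \<open>beta j\<close> spoils only finitely
  many signs, so the image is still negative for some \<open>k0 < 0\<close> and positive for some
  \<open>k1 >= 0\<close>. Where it changes from negative to positive, \<open>cox_inversion\<close>
  finds a \<open>beta i\<close>.\<close>

lemma centralizer_orbit:
  assumes c: "centralizes ks" and j: "j < n"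
  shows "\<exists>k i. i < n \<and> act ks (beta j) = cox k (beta i)"
proof -
  have ks: "set ks \<subseteq> {..<n}" using c by (simp add: centralizes_def)
  note fin = finite_inversions[OF ks]
  have root: "cox k (act ks (beta j)) \<in> roots" for k
    using j ks by (simp add: act_root beta_root cox_root)
  obtain k1 where k1: "0 \<le> k1" "nonneg (cox k1 (act ks (beta j)))"
  proof (rule ccontr)
    assume *: "\<not> thesis"
    have "range (\<lambda>k. cox (int k) (beta j)) \<subseteq> {x \<in> roots. nonneg x \<and> nonpos (act ks x)}"
    proof clarify
      fix k :: nat
      have "\<not> nonneg (cox (int k) (act ks (beta j)))" using * that[of "int k"] by auto
      then have "nonpos (act ks (cox (int k) (beta j)))"
        using root_sign[OF root, of "int k"] by (simp add: centralizes_cox[OF c])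
      then show "cox (int k) (beta j) \<in> roots \<and> nonneg (cox (int k) (beta j)) \<and>
          nonpos (act ks (cox (int k) (beta j)))"
        using j by (simp add: cox_root beta_root nonneg_cox_beta)
    qed
    moreover have "inj (\<lambda>k. cox (int k) (beta j))"
      using cox_beta_eqD[OF j j] by (intro injI) fastforce
    ultimately show False using fin finite_imageD finite_subset infinite_UNIV_nat by blast
  qed
  obtain k0 where k0: "k0 < 0" "nonpos (cox k0 (act ks (beta j)))"
  proof (rule ccontr)
    assume *: "\<not> thesis"
    have "range (\<lambda>k l. - cox (- 1 - int k) (beta j) l) \<subseteq> {x \<in> roots. nonneg x \<and> nonpos (act ks x)}"
    proof clarify
      fix k :: nat
      have "\<not> nonpos (cox (- 1 - int k) (act ks (beta j)))" using * that[of "- 1 - int k"] by auto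
      then have "nonpos (act ks (\<lambda>l. - cox (- 1 - int k) (beta j) l))"
        using root_sign[OF root, of "- 1 - int k"] by (simp add: centralizes_cox[OF c] act_minus)
      then show "(\<lambda>l. - cox (- 1 - int k) (beta j) l) \<in> roots \<and>
          nonneg (\<lambda>l. - cox (- 1 - int k) (beta j) l) \<and>
          nonpos (act ks (\<lambda>l. - cox (- 1 - int k) (beta j) l))"
        using j by (simp add: root_uminus cox_root beta_root nonpos_cox_beta)
    qed
    moreover have "inj (\<lambda>k l. - cox (- 1 - int k) (beta j) l)"
    proof (rule injI)
      fix k k' assume "(\<lambda>l. - cox (- 1 - int k) (beta j) l) = (\<lambda>l. - cox (- 1 - int k') (beta j) l)"
      then have "cox (- 1 - int k) (beta j) = cox (- 1 - int k') (beta j)"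
        by (simp add: fun_eq_iff)
      then show "k = k'" using cox_beta_eqD[OF j j] by fastforce
    qed
    ultimately show False using fin finite_imageD finite_subset infinite_UNIV_nat by blast
  qed
  define P where "P m = nonneg (cox (k0 + int m) (act ks (beta j)))" for m
  have "P (nat (k1 - k0))" using k1 k0 by (simp add: P_def)
  then have Pm: "P (LEAST m. P m)" by (rule LeastI)
  define m where "m = (LEAST m. P m)"
  have "\<not> P 0" using k0 root_sign_unique[OF root] by (auto simp: P_def)
  then have "m \<noteq> 0" using Pm unfolding m_def by metis
  then have nP: "\<not> P (m - 1)" using not_less_Least[of "m - 1" P] by (simp add: m_def)
  define x where "x = cox (k0 + int m) (act ks (beta j))"
  have "cox (- 1) x = cox (k0 + int (m - 1)) (act ks (beta j))"
    using \<open>m \<noteq> 0\<close> by (simp add: x_def cox_add[symmetric] of_nat_diff algebra_simps)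
  then have "nonpos (cox (- 1) x)"
    using nP root_sign[OF root, of "k0 + int (m - 1)"] by (auto simp: P_def)
  moreover have "nonneg x" "x \<in> roots" using Pm root by (auto simp: x_def P_def m_def)
  ultimately obtain i where i: "i < n" "x = beta i" using cox_inversion by blast
  then have "act ks (beta j) = cox (- (k0 + int m)) (beta i)"
    by (metis x_def cox_cancel(2))
  with i show ?thesis by blast
qed

lemma act_eqI:
  assumes "\<And>j. j < n \<Longrightarrow> act ks (beta j) = act ls (beta j)" "supported {..<n} x"
  shows "act ks x = act ls x"
proof -
  define q where "q k = (\<Sum>i<n. x i * euler_entry i k)" for k
  have x: "x = (\<lambda>j. \<Sum>k<n. q k * beta k j)"
    unfolding q_def by (rule beta_expand[OF assms(2)])
  show ?thesis
    by (subst (1 2) x) (simp add: act_sum assms(1))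
qed

lemma euler_preserving_diagonal:
  assumes c: "centralizes ks"
    and s: "\<And>j. j < n \<Longrightarrow> act ks (beta j) = cox (s j) (beta j)"
    and e: "\<And>x y. x \<in> roots \<Longrightarrow> y \<in> roots \<Longrightarrow> euler (act ks x) (act ks y) = euler x y"
  shows "\<exists>k. \<forall>x. supported {..<n} x \<longrightarrow> act ks x = cox k x"
proof -
  have "{..<n} \<noteq> {}" using infinite_roots by (auto simp: roots_def)
  then have ne: "s ` {..<n} \<noteq> {}" "finite (s ` {..<n})" by auto
  define m where "m = Min (s ` {..<n})"
  have m: "m \<le> s j" if "j < n" for j using ne that by (simp add: m_def)
  obtain i0 where i0: "i0 < n" "s i0 = m" using Min_in[OF ne(2,1)] by (auto simp: m_def)
  \<comment> \<open>The indices of non-minimal exponent; decoupling \<open>J\<close> from its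
    complement forces it to be empty.\<close>
  define J where "J = {j. j < n \<and> m < s j}"
  have "J = {} \<or> J = {..<n}"
  proof (rule connected)
    show "J \<subseteq> {..<n}" by (auto simp: J_def)
    fix j i assume ij: "j \<in> J" "i < n" "i \<notin> J"
    have zero: "cox k (beta j) i = 0" if jJ: "j \<in> J" and iJ: "i < n" "i \<notin> J" and k: "k = 0 \<or> k = 1" for j i k
    proof -
      have j: "j < n" using jJ by (simp add: J_def)
      define D where "D = s j - s i"
      have D: "0 < D" using jJ iJ m[of i] by (auto simp: J_def D_def)
      have per: "cox k (beta j) i = cox (k + D) (beta j) i" for k
      proof -
        have "cox k (beta j) i = euler (beta i) (cox k (beta j))"
          using iJ by (simp add: euler_beta)
        also have "\<dots> = euler (cox (s i) (beta i)) (cox k (cox (s j) (beta j)))"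
          using e[of "beta i" "cox k (beta j)"] iJ j by (simp add: s centralizes_cox[OF c] beta_root cox_root)
        also have "\<dots> = euler (beta i) (cox (k + D) (beta j))"
          using euler_shift[of "beta i" "k + D" "beta j" "s i"]
          by (simp add: cox_add[symmetric] D_def algebra_simps)
        finally show ?thesis using iJ by (simp add: euler_beta)
      qed
      \<comment> \<open>One period may only lead from \<open>1\<close> to \<open>0\<close>; as
        \<open>D >= 1\<close> and \<open>k <= 1\<close>, two periods reach a negative exponent,
        where the sign is opposite.\<close>
      have "cox k (beta j) i = cox (k - D - D) (beta j) i"
        using per[of "k - D"] per[of "k - D - D"] by simp
      moreover have "k - D - D < 0" "0 \<le> k" using D k by auto
      ultimately show ?thesis
        using nonneg_cox_beta_int[OF j, of k] nonpos_cox_beta[OF j, of "k - D - D"]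
        unfolding nonneg_def nonpos_def by (metis antisym)
    qed
    have "supported J (cox k (beta j))" if "j \<in> J" "k = 0 \<or> k = 1" for j k
      unfolding supported_def
    proof (intro allI impI)
      fix i assume "i \<notin> J"
      then show "cox k (beta j) i = 0"
        using zero[of j i k] that root_supported[OF cox_root[OF beta_root[of j]], of k]
        by (cases "i < n") (auto simp: J_def supported_def)
    qed
    from this[of _ 0] this[of _ 1] show "a j i = 0"
      using ij by (intro stable_support_decouples[of J]) (auto simp: J_def)
  qed
  moreover have "J \<noteq> {..<n}" using i0 by (auto simp: J_def)
  ultimately have sm: "s j = m" if "j < n" for j
    using m[OF that] that by (auto simp: J_def)
  have "act ks x = cox m x" if "supported {..<n} x" for x
    using act_eqI[OF _ that, of ks "cox_word m"] s sm by (simp add: cox_def)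
  then show ?thesis by blast
qed

end

section \<open>Invariance of the Euler form under the centralizer\<close>

context infinite_coxeter_roots
begin

text \<open>The exchange argument: by \<open>inversion_split\<close> a suffix of \<open>us\<close>
  sends \<open>bvec l\<close> to some \<open>bvec i\<close>; moved left past this suffix, the letter
  \<open>l\<close> becomes \<open>i\<close> and cancels against the \<open>i\<close> before
  it.\<close>

lemma act_append_simple_shorten:
  assumes "set us \<subseteq> {..<n}" "l < n" "nonpos (act us (bvec l))"
  shows "\<exists>vs. set vs \<subseteq> {..<n} \<and> length vs < length us \<and> (\<forall>y. act (us @ [l]) y = act vs y)"
proof -
  obtain us1 i us2 where us: "us = us1 @ i # us2" "act us2 (bvec l) = bvec i"
    using inversion_split[OF bvec_root[OF assms(2)] nonneg_bvec assms(1,3)] by blast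
  have "act (us @ [l]) y = act (us1 @ us2) y" for y
    using us assms(1,2) act_conj_reflect[of us2 l i y] by simp
  then show ?thesis using us assms(1) by (intro exI[of _ "us1 @ us2"]) auto
qed

lemma act_snoc: "l < n \<Longrightarrow> act (us @ [l]) y = (\<lambda>j. act us y j - coroot l y * act us (bvec l) j)"
  by (simp add: reflect_eq act_diff act_scale)

text \<open>Appending a letter \<open>l\<close> to \<open>us\<close> shifts the weight by the
  multiple \<open>act us (bvec l) i\<close> of a simple root. This is nonnegative if the root
  \<open>act us (bvec l)\<close> is positive; otherwise the word can be shortened, hence the
  induction on length.\<close>

lemma coordinate_dominance:
  assumes "set ks \<subseteq> {..<n}" "i < n"
  shows "\<exists>p. nonneg p \<and> supported {..<n} p \<and> (\<forall>y. act ks y i = y i - form p y)"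
  using assms(1)
proof (induction ks rule: length_induct)
  case (1 ks)
  show ?case
  proof (cases ks rule: rev_cases)
    case Nil
    then show ?thesis
      by (intro exI[of _ "\<lambda>j. 0"]) (auto simp: nonneg_def supported_def form_def)
  next
    case (snoc us l)
    then have l: "l < n" and us: "set us \<subseteq> {..<n}" using 1 by auto
    show ?thesis
    proof (cases "nonneg (act us (bvec l))")
      case True
      obtain p where p: "nonneg p" "supported {..<n} p" "\<forall>y. act us y i = y i - form p y"
        using 1 us snoc by auto
      define p' where "p' = (\<lambda>j. p j + act us (bvec l) i * bvec l j)"
      have "nonneg p'" "supported {..<n} p'"
        using p(1,2) True nonneg_bvec[of l] supported_bvec[of l "{..<n}"] l
        by (simp_all add: p'_def nonneg_def supported_def)
      moreover have "act ks y i = y i - form p' y" for y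
        using p l by (simp add: snoc act_snoc p'_def form_add_left form_scale_left del: act_append)
      ultimately show ?thesis by blast
    next
      case False
      then have "nonpos (act us (bvec l))"
        using root_sign[OF act_root[OF bvec_root[OF l] us]] by simp
      then obtain vs where "set vs \<subseteq> {..<n}" "length vs < length us" "\<forall>y. act ks y = act vs y"
        using act_append_simple_shorten[OF us l] snoc by blast
      then show ?thesis using 1 snoc by fastforce
    qed
  qed
qed

text \<open>The coordinate functionals are the fundamental weights, dominant and in distinct orbits.\<close>

lemma coordinate_orbit_unique:
  assumes "set ks \<subseteq> {..<n}" "i < n" "j < n" "\<And>y. supported {..<n} y \<Longrightarrow> act ks y i = y j"
  shows "i = j"
  using assms(1,4)
proof (induction ks rule: length_induct)
  case (1 ks)
  show ?case
  proof (cases ks rule: rev_cases)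
    case Nil
    then show ?thesis
      using 1(3)[of "bvec j"] assms(3) supported_bvec[of j "{..<n}"] by (auto simp: bvec_def split: if_splits)
  next
    case (snoc us l)
    then have l: "l < n" and us: "set us \<subseteq> {..<n}" using 1 by auto
    show ?thesis
    proof (cases "nonneg (act us (bvec l))")
      case True
      have "act ks (bvec l) i = - act us (bvec l) i"
        using l by (simp add: snoc act_snoc diag del: act_append)
      then have "l \<noteq> j"
        using 1(3)[of "bvec l"] l True supported_bvec[of l "{..<n}"] by (auto simp: nonneg_def bvec_def)
          (metis neg_0_le_iff_le not_one_le_zero)
      have "act us y i = y j" if "supported {..<n} y" for y
      proof -
        have "supported {..<n} (reflect l y)"
          using supported_act[of "[l]" "{..<n}" y] that l by simp
        then show ?thesis
          using 1(3)[of "reflect l y"] l \<open>l \<noteq> j\<close> by (simp add: snoc) (simp add: reflect_def)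
      qed
      then show ?thesis using 1 us snoc by auto
    next
      case False
      then have "nonpos (act us (bvec l))"
        using root_sign[OF act_root[OF bvec_root[OF l] us]] by simp
      then obtain vs where "set vs \<subseteq> {..<n}" "length vs < length us" "\<forall>y. act ks y = act vs y"
        using act_append_simple_shorten[OF us l] snoc by blast
      then show ?thesis using 1 snoc by (metis length_append_singleton less_SucI)
    qed
  qed
qed

section \<open>The radical of the invariant form\<close>

definition radical :: "vec \<Rightarrow> bool" where
  "radical r \<longleftrightarrow> supported {..<n} r \<and> (\<forall>i<n. coroot i r = 0)"

lemma radicalI:
  assumes "supported {..<n} r" "\<And>y. supported {..<n} y \<Longrightarrow> form r y = 0"
  shows "radical r"
proof -
  have "coroot i r = 0" if "i < n" for i
    using form_commute[of r "bvec i"] assms(2)[of "bvec i"] that supported_bvec[of i "{..<n}"] by simp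
  then show ?thesis using assms(1) by (simp add: radical_def)
qed

lemma act_radical: "radical r \<Longrightarrow> set ks \<subseteq> {..<n} \<Longrightarrow> act ks r = r"
  by (induction ks) (auto simp: radical_def reflect_def)

text \<open>A Perron-Frobenius argument: at an index in the zero set \<open>Z\<close> all terms of
  the vanishing coroot sum are nonpositive, hence zero, so \<open>Z\<close> is decoupled from its
  complement.\<close>

lemma nonneg_radical_pos:
  assumes r: "radical r" "nonneg r" "r \<noteq> (\<lambda>j. 0)" and "i < n"
  shows "0 < r i"
proof -
  define Z where "Z = {i. i < n \<and> r i = 0}"
  have "Z = {} \<or> Z = {..<n}"
  proof (rule connected)
    show "Z \<subseteq> {..<n}" by (auto simp: Z_def)
    fix i j assume ij: "i \<in> Z" "j < n" "j \<notin> Z"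
    have "a i k * r k \<le> 0" if "k < n" for k
      using ij that offdiag[of i k] r(2) unfolding Z_def nonneg_def
      by (cases "k = i") (auto intro: mult_nonpos_nonneg)
    moreover have "(\<Sum>k<n. a i k * r k) = 0"
      using r(1) ij by (auto simp: radical_def coroot_def Z_def)
    ultimately have "a i j * r j = 0"
      using sum_nonneg_eq_0_iff[of "{..<n}" "\<lambda>k. - (a i k * r k)"] ij by (auto simp: sum_negf)
    then show "a i j = 0" using ij by (auto simp: Z_def)
  qed
  moreover have "Z \<noteq> {..<n}"
    using r by (auto simp: Z_def radical_def supported_def fun_eq_iff)
  ultimately have "r i \<noteq> 0" using assms(4) by (auto simp: Z_def)
  then show ?thesis using r(2) by (simp add: nonneg_def order_less_le)
qed

text \<open>Subtracting from \<open>r'\<close> the multiple of \<open>r\<close> by the least ratio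
  \<open>t\<close> of coordinates leaves a nonnegative radical vector with a zero coordinate, which
  is zero.\<close>

lemma nonneg_radical_unique:
  assumes r: "radical r" "nonneg r" "r \<noteq> (\<lambda>j. 0)" and r': "radical r'"
  shows "\<exists>t. r' = (\<lambda>j. t * r j)"
proof -
  have pos: "0 < r i" if "i < n" for i using nonneg_radical_pos[OF r that] .
  define t where "t = Min ((\<lambda>i. r' i / r i) ` {..<n})"
  have "{..<n} \<noteq> {}" using infinite_roots by (auto simp: roots_def)
  then have ne: "(\<lambda>i. r' i / r i) ` {..<n} \<noteq> {}" "finite ((\<lambda>i. r' i / r i) ` {..<n})" by auto
  obtain i0 where "i0 < n" "t = r' i0 / r i0"
    using Min_in[OF ne(2,1)] by (auto simp: t_def)
  then have i0: "i0 < n" "r' i0 = t * r i0"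
    using pos[of i0] by simp_all
  have le: "t * r i \<le> r' i" if "i < n" for i
  proof -
    have "t \<le> r' i / r i" unfolding t_def using that by (intro Min_le[OF ne(2)]) auto
    then show ?thesis using pos[OF that] by (simp add: pos_le_divide_eq)
  qed
  define q where "q = (\<lambda>j. r' j - t * r j)"
  have "coroot i q = coroot i r' - t * coroot i r" for i
    by (simp add: q_def coroot_def algebra_simps sum_subtractf sum_distrib_left)
  then have "radical q"
    using r(1) r' by (auto simp: radical_def q_def supported_def)
  moreover have "nonneg q"
    unfolding nonneg_def
  proof
    fix j show "0 \<le> q j"
      using le[of j] r(1) r' by (cases "j < n") (auto simp: q_def radical_def supported_def)
  qed
  moreover have "q i0 = 0" using i0 by (simp add: q_def)
  ultimately have "q = (\<lambda>j. 0)"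
    using nonneg_radical_pos[of q i0] i0 by auto
  then show ?thesis by (intro exI[of _ t]) (auto simp: q_def fun_eq_iff)
qed

section \<open>The failure of a word to preserve the Euler form\<close>

definition defect :: "nat list \<Rightarrow> vec \<Rightarrow> vec \<Rightarrow> real" where
  "defect ks x y = euler (act ks x) (act ks y) - euler x y"

lemma defect_skew: "set ks \<subseteq> {..<n} \<Longrightarrow> defect ks y x = - defect ks x y"
  using euler_symmetrize[of x y] euler_symmetrize[of "act ks x" "act ks y"]
  by (simp add: defect_def)

text \<open>\<open>euler_cox_left\<close> trades the Coxeter element for a swap of the arguments and
  a sign, in both terms because \<open>ks\<close> commutes with it; skewness undoes the
  swap.\<close>

lemma defect_cox_1:
  assumes "centralizes ks"
  shows "defect ks (cox 1 x) y = defect ks x y"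
  using assms defect_skew[of ks y x]
  by (simp add: defect_def centralizes_cox[OF assms] euler_cox_left centralizes_def)

lemma defect_cox_left:
  assumes "centralizes ks"
  shows "defect ks (cox k x) y = defect ks x y"
proof (induction k rule: int_induct[where k = 0])
  case (step1 i)
  then show ?case by (simp add: cox_Suc defect_cox_1[OF assms])
next
  case (step2 i)
  then show ?case
    using defect_cox_1[OF assms, of "cox (i - 1) x"] cox_Suc[of "i - 1" x] by simp
qed simp

lemma defect_cox_right:
  assumes "centralizes ks"
  shows "defect ks x (cox k y) = defect ks x y"
  using defect_cox_left[OF assms] defect_skew assms by (metis centralizes_def)

lemma defect_sum_right:
  "finite A \<Longrightarrow> defect ks x (\<lambda>j. \<Sum>l\<in>A. p l * v l j) = (\<Sum>l\<in>A. p l * defect ks x (v l))"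
  by (simp add: defect_def act_sum euler_sum_right sum_subtractf algebra_simps)

lemma defect_sum_left:
  "finite A \<Longrightarrow> defect ks (\<lambda>j. \<Sum>l\<in>A. p l * v l j) y = (\<Sum>l\<in>A. p l * defect ks (v l) y)"
  by (simp add: defect_def act_sum euler_sum_left sum_subtractf algebra_simps)

lemma defect_add_right: "defect ks x (\<lambda>j. y j + z j) = defect ks x y + defect ks x z"
  and defect_scale_right: "defect ks x (\<lambda>j. q * y j) = q * defect ks x y"
  and defect_diff_left: "defect ks (\<lambda>j. y j - z j) x = defect ks y x - defect ks z x"
  by (simp_all add: defect_def act_add act_scale act_diff euler_add_right euler_scale_right
      euler_diff_left algebra_simps)

text \<open>The \<open>beta i\<close> are dual to the simple roots under \<open>euler\<close>, so
  any linear functional is \<open>euler r\<close> for some \<open>r\<close>. Then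
  \<open>form r y\<close> is the difference of its values at \<open>y\<close> and
  \<open>cox (- 1) y\<close>, which agree.\<close>

lemma defect_radical:
  assumes "centralizes ks"
  shows "\<exists>r. radical r \<and> (\<forall>y. supported {..<n} y \<longrightarrow> defect ks x y = euler r y)"
proof -
  define r where "r = (\<lambda>j. \<Sum>i<n. defect ks x (bvec i) * beta i j)"
  have eq: "defect ks x y = euler r y" if "supported {..<n} y" for y
  proof -
    have "defect ks x y = defect ks x (\<lambda>j. \<Sum>i<n. y i * bvec i j)"
      using expand[OF that] by simp
    also have "\<dots> = euler r y"
      unfolding r_def
      by (simp add: defect_sum_right euler_sum_left euler_beta) (simp add: mult.commute)
    finally show ?thesis .
  qed
  have "radical r"
  proof (rule radicalI)
    show "supported {..<n} r"
      using beta_supported by (auto simp: r_def supported_def intro!: sum.neutral)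
    fix y assume y: "supported {..<n} y"
    have "form r y = euler r y - euler r (cox (- 1) y)"
      using form_eq_euler euler_shift[of r "-1" y 1] by simp
    also have "\<dots> = 0"
      using eq[OF y] eq[of "cox (- 1) y"] supported_act[OF set_cox_word y]
      by (simp add: defect_cox_right[OF assms] cox_def[symmetric])
    finally show "form r y = 0" .
  qed
  with eq show ?thesis by blast
qed

text \<open>The radical is spanned by \<open>r\<close>, so the defect is
  \<open>t x * euler r y\<close>; a skew form of rank at most one vanishes.\<close>

lemma defect_zero_affine:
  assumes c: "centralizes ks" and r: "radical r" "nonneg r" "r \<noteq> (\<lambda>j. 0)"
    and xy: "supported {..<n} x" "supported {..<n} y"
  shows "defect ks x y = 0"
proof -
  have "\<exists>t. \<forall>y. supported {..<n} y \<longrightarrow> defect ks x y = t * euler r y" for x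
    using defect_radical[OF c, of x] nonneg_radical_unique[OF r] euler_scale_left by metis
  then obtain t where t: "\<And>x y. supported {..<n} y \<Longrightarrow> defect ks x y = t x * euler r y"
    by metis
  have sk: "defect ks x y = - defect ks y x" for x y
    using defect_skew[of ks y x] c by (simp add: centralizes_def)
  have "t x * euler r x = 0"
    using sk[of x x] t[OF xy(1), of x] by simp
  then show ?thesis
    using t[OF xy(2), of x] t[OF xy(1), of y] sk[of x y] by auto
qed

text \<open>Each reflection changes \<open>L\<close> by a multiple of the pairing with a root. For
  degenerate \<open>form\<close> the functional \<open>L\<close> need not itself be a pairing with a
  vector, but its shift is.\<close>

lemma act_functional_shift:
  assumes add: "\<And>y z. L (\<lambda>j. y j + z j) = L y + L z"
    and scale: "\<And>q y. L (\<lambda>j. q * y j) = q * L y"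
    and ks: "set ks \<subseteq> {..<n}"
  shows "\<exists>q. supported {..<n} q \<and> (\<forall>y. L (act ks y) = L y - form q y)"
  using ks
proof (induction ks)
  case Nil
  then show ?case by (intro exI[of _ "\<lambda>j. 0"]) (auto simp: supported_def form_def)
next
  case (Cons k ks)
  then have k: "k < n" and ks: "set ks \<subseteq> {..<n}" by auto
  obtain q where q: "supported {..<n} q" "\<forall>y. L (act ks y) = L y - form q y"
    using Cons by auto
  define b where "b = act (rev ks) (bvec k)"
  have "supported {..<n} b"
    unfolding b_def using k ks by (intro supported_act supported_bvec) auto
  define q' where "q' = (\<lambda>j. q j + L (bvec k) * b j)"
  have "L (act (k # ks) y) = L y - form q' y" for y
  proof -
    have "coroot k (act ks y) = form b y"
      using form_act_left[of "rev ks" "bvec k" y] k ks by (simp add: b_def)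
    moreover have "act (k # ks) y = (\<lambda>j. act ks y j + (- coroot k (act ks y)) * bvec k j)"
      by (simp add: reflect_eq)
    ultimately show ?thesis
      using q by (simp only: add scale) (simp add: q'_def form_add_left form_scale_left)
  qed
  moreover have "supported {..<n} q'"
    using q \<open>supported {..<n} b\<close> by (simp add: q'_def supported_def)
  ultimately show ?case by blast
qed

text \<open>Up to a power of the Coxeter element, \<open>ks\<close> shifts the \<open>i\<close>-th fundamental weight by the
  functional \<open>defect ks (beta i)\<close>, and its inverse shifts it by the negative. By dominance both
  shifts are nonpositive combinations of simple roots.\<close>

lemma defect_zero_indefinite:
  assumes c: "centralizes ks"
    and s: "\<And>j. j < n \<Longrightarrow> act ks (beta j) = cox (s j) (beta j)"
    and no_rad: "\<And>r. radical r \<Longrightarrow> nonneg r \<Longrightarrow> r = (\<lambda>j. 0)"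
    and xy: "supported {..<n} x" "supported {..<n} y"
  shows "defect ks x y = 0"
proof -
  have ks: "set ks \<subseteq> {..<n}" using c by (simp add: centralizes_def)
  have main: "defect ks (beta i) y = 0" if i: "i < n" and y: "supported {..<n} y" for i y
  proof -
    define us where "us = cox_word (- s i) @ ks"
    have us: "set us \<subseteq> {..<n}" using ks set_cox_word by (simp add: us_def)
    have us_i: "act us z i = z i + defect ks (beta i) z" for z
    proof -
      have "act us z i = euler (beta i) (cox (- s i) (act ks z))"
        using i by (simp add: us_def cox_def euler_beta)
      also have "\<dots> = euler (act ks (beta i)) (act ks z)"
        using euler_shift[of "beta i" "- s i" "act ks z" "s i"] s[OF i] by simp
      finally show ?thesis using i by (simp add: defect_def euler_beta)
    qed
    \<comment> \<open>\<open>ks\<close> moves each \<open>beta k\<close> within its orbit under the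
      Coxeter element, which the defect does not see, and the \<open>beta k\<close> span.\<close>
    have inv: "defect ks (beta i) (act us z) = defect ks (beta i) z" if z: "supported {..<n} z" for z
    proof -
      have "act us z = cox (- s i) (act ks z)" by (simp add: us_def cox_def)
      then have "defect ks (beta i) (act us z) = defect ks (beta i) (act ks z)"
        by (simp add: defect_cox_right[OF c])
      also have "\<dots> = defect ks (beta i) z"
      proof -
        define q where "q k = (\<Sum>i<n. z i * euler_entry i k)" for k
        have z': "z = (\<lambda>j. \<Sum>k<n. q k * beta k j)"
          unfolding q_def by (rule beta_expand[OF z])
        show ?thesis
          unfolding z' by (simp add: act_sum defect_sum_right s defect_cox_right[OF c])
      qed
      finally show ?thesis .
    qed
    obtain p where p: "nonneg p" "supported {..<n} p" "\<And>z. act us z i = z i - form p z"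
      using coordinate_dominance[OF us i] by blast
    obtain p' where p': "nonneg p'" "supported {..<n} p'" "\<And>z. act (rev us) z i = z i - form p' z"
      using coordinate_dominance[of "rev us" i] us i by auto
    have 1: "defect ks (beta i) z = - form p z" for z using us_i[of z] p(3)[of z] by simp
    \<comment> \<open>Evaluating \<open>us_i\<close> at \<open>act (rev us) z\<close> expresses the
      same functional through the inverse word, with the opposite sign; so \<open>p + p'\<close>
      pairs to zero with everything.\<close>
    have 2: "defect ks (beta i) z = form p' z" if z: "supported {..<n} z" for z
    proof -
      have z': "supported {..<n} (act (rev us) z)" using us z by (intro supported_act) auto
      have "z i = act us (act (rev us) z) i" using us by simp
      also have "\<dots> = z i - form p' z + defect ks (beta i) z"
        using us_i[of "act (rev us) z"] p'(3)[of z] inv[OF z'] us by simp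
      finally show ?thesis by simp
    qed
    have "radical (\<lambda>j. p j + p' j)"
    proof (rule radicalI)
      show "supported {..<n} (\<lambda>j. p j + p' j)" using p p' by (simp add: supported_def)
      show "form (\<lambda>j. p j + p' j) z = 0" if "supported {..<n} z" for z
        using 1[of z] 2[OF that] by (simp add: form_add_left)
    qed
    moreover have "nonneg (\<lambda>j. p j + p' j)" using p p' by (simp add: nonneg_def)
    ultimately have "(\<lambda>j. p j + p' j) = (\<lambda>j. 0)" by (rule no_rad)
    then have "p = (\<lambda>j. 0)"
      using p(1) p'(1) unfolding nonneg_def fun_eq_iff by (metis add_nonneg_eq_0_iff)
    then show ?thesis using 1[of y] by (simp add: form_def)
  qed
  have "defect ks x y = (\<Sum>k<n. (\<Sum>i<n. x i * euler_entry i k) * defect ks (beta k) y)"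
    by (subst (1) beta_expand[OF xy(1)]) (simp add: defect_sum_left)
  then show ?thesis using main xy by simp
qed

lemma act_replicate: "act (concat (replicate m ks)) x = ((act ks) ^^ m) x"
  by (induction m) auto

text \<open>The functionals invariant under the Coxeter element turn out to be invariant under \<open>ks\<close> as
  well, so the defect of the \<open>m\<close>-th power is \<open>m\<close> times the defect; but the former is \<open>0\<close>.\<close>

lemma defect_zero_of_power:
  assumes c: "centralizes ks" and m: "0 < m"
    and pw: "\<And>x. supported {..<n} x \<Longrightarrow> (act ks ^^ m) x = cox A x"
    and xy: "supported {..<n} x" "supported {..<n} y"
  shows "defect ks x y = 0"
proof -
  have ks: "set ks \<subseteq> {..<n}" using c by (simp add: centralizes_def)
  have inv: "defect ks x (act ks y) = defect ks x y" if "supported {..<n} y" for x y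
  proof -
    obtain q where q: "supported {..<n} q" "\<And>y. defect ks x (act ks y) = defect ks x y - form q y"
      using act_functional_shift[of "defect ks x", OF defect_add_right defect_scale_right ks] by blast
    \<comment> \<open>\<open>form q\<close> is invariant under the Coxeter element, so
      \<open>r\<close> is radical, and \<open>form_eq_euler\<close> gives
      \<open>form q z = - euler r z\<close>. As \<open>ks\<close> fixes \<open>r\<close> and
      \<open>r\<close> has no defect, \<open>form q\<close> is invariant under \<open>ks\<close>
      too.\<close>
    define r where "r = (\<lambda>j. cox 1 q j - q j)"
    have "radical r"
    proof (rule radicalI)
      have "supported {..<n} (cox 1 q)"
        unfolding cox_def using set_cox_word q(1) by (rule supported_act)
      then show "supported {..<n} r" using q(1) by (simp add: r_def supported_def)
      fix z
      have "form (cox 1 q) z = form q (cox (- 1) z)"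
        using form_cox[of 1 q "cox (- 1) z"] cox_cancel(1)[of 1 z] by simp
      moreover have "form q (cox (- 1) z) = form q z"
        using q(2)[of z] q(2)[of "cox (- 1) z"] by (simp add: centralizes_cox[OF c] defect_cox_right[OF c])
      ultimately show "form r z = 0" by (simp add: r_def form_diff_left)
    qed
    then have "act ks r = r" using ks by (rule act_radical)
    moreover have "defect ks r z = 0" for z
      by (simp add: r_def defect_diff_left defect_cox_left[OF c])
    ultimately have "euler r (act ks z) = euler r z" for z
      by (metis defect_def eq_iff_diff_eq_0)
    moreover have "form q z = - euler r z" for z
      by (simp add: form_eq_euler r_def euler_diff_left)
    ultimately have fq: "form q (act ks z) = form q z" for z by simp
    have fqr: "form q ((act ks ^^ k) z) = form q z" for k z
      by (induction k) (simp_all add: fq)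
    \<comment> \<open>Each application subtracts the same amount, yet after \<open>m\<close> of them
      the total is a power of the Coxeter element, which leaves the defect unchanged.\<close>
    have "defect ks x ((act ks ^^ k) y) = defect ks x y - real k * form q y" for k
      by (induction k) (simp_all add: q(2) fqr algebra_simps)
    then have "defect ks x (cox A y) = defect ks x y - real m * form q y"
      using pw[OF that] by metis
    then have "form q y = 0" using m by (simp add: defect_cox_right[OF c])
    then show ?thesis using q(2) by simp
  qed
  have supp: "supported {..<n} ((act ks ^^ k) z)" if "supported {..<n} z" for k z
    by (induction k) (simp_all add: that supported_act[OF ks])
  have inv2: "defect ks ((act ks ^^ k) x) ((act ks ^^ k) y) = defect ks x y" for k
  proof (induction k)
    case (Suc k)
    have "defect ks (act ks u) (act ks v) = defect ks u v"
      if "supported {..<n} u" "supported {..<n} v" for u v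
      using inv[OF that(1)] inv[OF that(2)] defect_skew[OF ks] by metis
    then show ?case using Suc supp xy by simp
  qed simp
  have "euler ((act ks ^^ k) x) ((act ks ^^ k) y) = euler x y + real k * defect ks x y" for k
  proof (induction k)
    case (Suc k)
    then show ?case using inv2[of k] by (simp add: defect_def algebra_simps)
  qed simp
  from this[of m] show ?thesis using pw[OF xy(1)] pw[OF xy(2)] m by simp
qed

text \<open>In the case without a nonzero nonnegative radical vector, a suitable power of
  \<open>ks\<close> maps each \<open>beta j\<close> into its own orbit, because the permutation
  \<sigma> of the orbits has finite order. That power has zero defect, hence equals
  \<open>cox A\<close>, and \<open>defect_zero_of_power\<close> returns to
  \<open>ks\<close>.\<close>

lemma centralizer_preserves_euler:
  assumes c: "centralizes ks" and xy: "supported {..<n} x" "supported {..<n} y"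
  shows "euler (act ks x) (act ks y) = euler x y"
proof (cases "\<exists>r. radical r \<and> nonneg r \<and> r \<noteq> (\<lambda>j. 0)")
  case True
  then show ?thesis using defect_zero_affine[OF c _ _ _ xy] by (auto simp: defect_def)
next
  case False
  have ks: "set ks \<subseteq> {..<n}" using c by (simp add: centralizes_def)
  obtain s \<sigma> where s: "\<And>j. j < n \<Longrightarrow> \<sigma> j < n \<and> act ks (beta j) = cox (s j) (beta (\<sigma> j))"
    using centralizer_orbit[OF c] by metis
  have inj: "inj_on \<sigma> {..<n}"
  proof (rule inj_onI)
    fix i j assume ij: "i \<in> {..<n}" "j \<in> {..<n}" "\<sigma> i = \<sigma> j"
    have "act ks (cox (s j - s i) (beta i)) = act ks (beta j)"
      using s[of i] s[of j] ij by (simp add: centralizes_cox[OF c] cox_add[symmetric])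
    then have "cox (s j - s i) (beta i) = cox 0 (beta j)"
      using act_rev_act(1)[OF ks] by (metis cox_0)
    then show "i = j" using cox_beta_eqD[of i j "s j - s i" 0] ij by auto
  qed
  define p where "p j = (if j < n then \<sigma> j else j)" for j
  have "p permutes {..<n}"
  proof (rule bij_imp_permutes)
    have "\<sigma> ` {..<n} = {..<n}" using s inj by (intro endo_inj_surj) auto
    then have "bij_betw \<sigma> {..<n} {..<n}" using inj by (simp add: bij_betw_def)
    then show "bij_betw p {..<n} {..<n}"
      by (rule bij_betw_cong[THEN iffD1, rotated]) (simp add: p_def)
  qed (simp add: p_def)
  then have "permutation p" using permutation_permutes by blast
  then obtain m where m: "p ^^ m = id" "m > 0" by (rule permutation_is_nilpotent)
  have pj: "(p ^^ k) j < n" if "j < n" for j k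
    using that s by (induction k) (auto simp: p_def)
  have step: "\<exists>t. (act ks ^^ k) (beta j) = cox t (beta ((p ^^ k) j))" if j: "j < n" for j k
  proof (induction k)
    case 0
    show ?case by (intro exI[of _ 0]) simp
  next
    case (Suc k)
    then obtain t where t: "(act ks ^^ k) (beta j) = cox t (beta ((p ^^ k) j))" by blast
    have "(act ks ^^ Suc k) (beta j) = cox (t + s ((p ^^ k) j)) (beta ((p ^^ Suc k) j))"
      using pj[OF j, of k] s[of "(p ^^ k) j"] by (simp add: t centralizes_cox[OF c] cox_add p_def)
    then show ?case by blast
  qed
  define ls where "ls = concat (replicate m ks)"
  have "\<exists>t. act ls (beta j) = cox t (beta j)" if "j < n" for j
    using step[OF that, of m] m by (simp add: ls_def act_replicate)
  then obtain t where t: "\<And>j. j < n \<Longrightarrow> act ls (beta j) = cox (t j) (beta j)" by metis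
  have comm: "(act ks ^^ k) (cox 1 x) = cox 1 ((act ks ^^ k) x)" for k x
    by (induction k) (simp_all add: centralizes_cox[OF c])
  have cls: "centralizes ls"
    using ks comm by (auto simp: centralizes_def ls_def act_replicate)
  have "defect ls x y = 0" if "supported {..<n} x" "supported {..<n} y" for x y
    using defect_zero_indefinite[OF cls t _ that] False by blast
  then have "\<exists>A. \<forall>x. supported {..<n} x \<longrightarrow> act ls x = cox A x"
    by (intro euler_preserving_diagonal[OF cls t]) (auto simp: defect_def root_supported)
  then obtain A where "\<And>x. supported {..<n} x \<Longrightarrow> (act ks ^^ m) x = cox A x"
    by (auto simp: ls_def act_replicate)
  from defect_zero_of_power[OF c m(2) this xy] show ?thesis
    by (simp add: defect_def)
qed

lemma centralizer_cox:
  assumes c: "centralizes ks"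
  shows "\<exists>k. \<forall>x. supported {..<n} x \<longrightarrow> act ks x = cox k x"
proof -
  have ks: "set ks \<subseteq> {..<n}" using c by (simp add: centralizes_def)
  have "\<exists>k. act ks (beta j) = cox k (beta j)" if j: "j < n" for j
  proof -
    obtain k i where i: "i < n" "act ks (beta j) = cox k (beta i)"
      using centralizer_orbit[OF c j] by blast
    \<comment> \<open>Preservation of the Euler form turns
      \<open>act ks (beta j) = cox k (beta i)\<close> into an identity of coordinate functionals:
      \<open>rev ks @ cox_word k\<close> carries the \<open>j\<close>-th one to the
      \<open>i\<close>-th.\<close>
    have "j = i"
    proof (rule coordinate_orbit_unique)
      show "set (rev ks @ cox_word k) \<subseteq> {..<n}" using ks set_cox_word by simp
      fix y assume y: "supported {..<n} y"
      have y': "supported {..<n} (act (rev ks @ cox_word k) y)"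
        using ks set_cox_word y by (intro supported_act) auto
      have "act (rev ks @ cox_word k) y j = euler (act ks (beta j)) (act ks (act (rev ks @ cox_word k) y))"
        using centralizer_preserves_euler[OF c beta_supported[OF j] y'] j by (simp only: euler_beta)
      also have "\<dots> = euler (cox k (beta i)) (cox k y)"
        using ks i by (simp add: cox_def)
      finally show "act (rev ks @ cox_word k) y j = y i" using i by (simp add: euler_beta)
    qed (use i j in auto)
    then show ?thesis using i by blast
  qed
  then obtain s where "\<And>j. j < n \<Longrightarrow> act ks (beta j) = cox (s j) (beta j)" by metis
  then show ?thesis
    by (rule euler_preserving_diagonal[OF c]) (auto intro: centralizer_preserves_euler[OF c] root_supported)
qed

end

section \<open>The geometric representation of a Coxeter group\<close>

text \<open>Chebyshev polynomials of the second kind, shifted by one: for \<open>p = 2 cos \<theta>\<close> the value at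
  \<open>k\<close> is \<open>sin (k \<theta>) / sin \<theta>\<close>.\<close>

fun cheb :: "real \<Rightarrow> nat \<Rightarrow> real" where
  "cheb p 0 = 0"
| "cheb p (Suc 0) = 1"
| "cheb p (Suc (Suc k)) = p * cheb p (Suc k) - cheb p k"

lemma cheb_norm: "cheb p k ^ 2 + cheb p (Suc k) ^ 2 - p * cheb p k * cheb p (Suc k) = 1"
  by (induction k) (simp_all add: power2_eq_square algebra_simps)

lemma cheb_cos: "sin \<theta> * cheb (2 * cos \<theta>) k = sin (real k * \<theta>)"
proof (induction k rule: induct_nat_012)
  case (ge2 k)
  have "sin (real (Suc (Suc k)) * \<theta>) = sin (real (Suc k) * \<theta> + \<theta>)"
    and "sin (real k * \<theta>) = sin (real (Suc k) * \<theta> - \<theta>)"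
    by (simp_all add: algebra_simps)
  then have "sin (real (Suc (Suc k)) * \<theta>) + sin (real k * \<theta>) = 2 * cos \<theta> * sin (real (Suc k) * \<theta>)"
    by (simp only: sin_add sin_diff) simp
  then show ?case using ge2 by (simp add: algebra_simps)
qed simp_all

lemma cheb_2: "cheb 2 k = real k"
  by (induction k rule: induct_nat_012) simp_all

fun alt :: "nat \<Rightarrow> nat \<Rightarrow> nat \<Rightarrow> nat list" where
  "alt s t 0 = []"
| "alt s t (Suc k) = alt t s k @ [t]"

lemma length_alt [simp]: "length (alt s t k) = k"
  by (induction k arbitrary: s t) auto

lemma set_alt: "set (alt s t k) \<subseteq> {s, t}"
  by (induction k arbitrary: s t) auto

lemma alt_Cons: "alt s t (Suc k) = (if even k then t else s) # alt s t k"
proof (induction k arbitrary: s t)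
  case (Suc k)
  have "alt s t (Suc (Suc k)) = alt t s (Suc k) @ [t]" by simp
  also have "\<dots> = (if even k then s else t) # alt t s k @ [t]"
    by (subst Suc) simp
  finally show ?case by simp
qed simp

lemma alt_add: "alt s t (k + l) = (if even l then alt s t k else alt t s k) @ alt s t l"
  by (induction l arbitrary: s t) simp_all

lemma rev_alt: "rev (if even k then alt s t k else alt t s k) = alt t s k"
proof (induction k)
  case (Suc k)
  show ?case
  proof (cases "even k")
    case True
    then have "rev (alt t s (Suc k)) = s # rev (alt s t k)" by simp
    also have "\<dots> = s # alt t s k" using Suc True by simp
    also have "\<dots> = alt t s (Suc k)" using True by (subst alt_Cons) simp
    finally show ?thesis using True by (simp only: even_Suc simp_thms if_False)
  next
    case False
    have "rev (alt s t (Suc k)) = t # rev (alt t s k)" by simp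
    also have "\<dots> = t # alt t s k" using Suc False by simp
    also have "\<dots> = alt t s (Suc k)" using False by (subst alt_Cons) simp
    finally show ?thesis using False by (simp only: even_Suc simp_thms if_True)
  qed
qed simp

lemma concat_replicate_alt: "concat (replicate k [s, t]) = alt s t (2 * k)"
proof (induction k)
  case (Suc k)
  have "alt s t (2 * Suc k) = alt s t (2 + 2 * k)" by simp
  also have "\<dots> = alt s t 2 @ alt s t (2 * k)" by (subst alt_add) simp
  also have "alt s t 2 = [s, t]" by (simp add: numeral_2_eq_2)
  finally show ?case using Suc by simp
qed simp

context cartan_matrix
begin

text \<open>Both coefficients contain the factor \<open>cheb (- a s t) k\<close>, so the power acts
  trivially when that value is zero; \<open>act_relator\<close> rests on this.\<close>

lemma act_dihedral:
  assumes "s < n" "t < n" "s \<noteq> t"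
  shows "act (concat (replicate k [s, t])) y = (\<lambda>j. y j
    - cheb (- a s t) k * (cheb (- a s t) (Suc k) * coroot t y + cheb (- a s t) k * coroot s y) * bvec s j
    - cheb (- a s t) k * (cheb (- a s t) k * coroot t y
        + (- a s t * cheb (- a s t) k - cheb (- a s t) (Suc k)) * coroot s y) * bvec t j)"
proof (induction k)
  case (Suc k)
  define p where "p = - a s t"
  define A where "A = cheb p k"
  define B where "B = cheb p (Suc k)"
  define u where "u = coroot s y"
  define v where "v = coroot t y"
  define X where "X = A * (B * v + A * u)"
  define Y where "Y = A * (A * v + (p * A - B) * u)"
  define z where "z = (\<lambda>j. y j + (- X) * bvec s j + (- Y) * bvec t j)"
  have norm: "A * A + B * B - p * A * B = 1"
    using cheb_norm[of p k] by (simp add: A_def B_def power2_eq_square)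
  have z: "act (concat (replicate k [s, t])) y = z"
    using Suc by (simp add: z_def X_def Y_def A_def B_def u_def v_def p_def)
  have ats: "a t s = - p" "a s t = - p" using assms by (simp_all add: p_def symm)
  have cz: "coroot s z = u - 2 * X + p * Y" "coroot t z = v + p * X - 2 * Y"
    unfolding z_def coroot_add coroot_scale
    using assms by (simp_all add: ats diag u_def v_def)
  have cs: "coroot s (reflect t z) = coroot s z + p * coroot t z"
  proof -
    have *: "reflect t z = (\<lambda>j. z j + (- coroot t z) * bvec t j)" by (simp add: reflect_eq)
    show ?thesis unfolding * coroot_add coroot_scale using assms by (simp add: ats)
  qed
  have X': "X + (coroot s z + p * coroot t z) = B * ((p * B - A) * v + B * u)"
  proof -
    \<comment> \<open>The two sides of \<open>X'\<close> differ by a multiple of the expression that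
      \<open>cheb_norm\<close> makes zero; likewise for \<open>Y'\<close>.\<close>
    have "X + (coroot s z + p * coroot t z) =
        B * ((p * B - A) * v + B * u) + (1 - (A * A + B * B - p * A * B)) * (u + p * v)"
      unfolding cz X_def Y_def by (simp add: algebra_simps)
    then show ?thesis by (simp add: norm)
  qed
  have Y': "Y + coroot t z = B * (B * v + A * u)"
  proof -
    have "Y + coroot t z = B * (B * v + A * u) + (1 - (A * A + B * B - p * A * B)) * v"
      unfolding cz X_def Y_def by (simp add: algebra_simps)
    then show ?thesis by (simp add: norm)
  qed
  have "act (concat (replicate (Suc k) [s, t])) y = reflect s (reflect t z)"
    using z by simp
  also have "\<dots> = (\<lambda>j. y j - (X + (coroot s z + p * coroot t z)) * bvec s j - (Y + coroot t z) * bvec t j)"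
    by (subst reflect_eq, subst cs) (simp add: reflect_eq z_def fun_eq_iff algebra_simps)
  finally show ?case
    unfolding X' Y' by (simp add: A_def B_def u_def v_def p_def algebra_simps)
qed simp

lemma act_alt:
  assumes "s < n" "t < n" "s \<noteq> t"
  shows "act (alt s t k) (bvec s) =
    (if even k then (\<lambda>j. cheb (- a s t) (Suc k) * bvec s j + cheb (- a s t) k * bvec t j)
     else (\<lambda>j. cheb (- a s t) k * bvec s j + cheb (- a s t) (Suc k) * bvec t j))"
proof (induction k)
  case (Suc k)
  have ats: "a t s = a s t" using assms by (simp add: symm)
  have "act (alt s t (Suc k)) (bvec s) = reflect (if even k then t else s) (act (alt s t k) (bvec s))"
    by (subst alt_Cons) simp
  then show ?case
    unfolding Suc using assms
    by (cases "even k")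
      (simp_all add: reflect_eq coroot_add coroot_scale diag ats del: alt.simps,
        simp_all add: algebra_simps fun_eq_iff del: alt.simps)
qed simp

end

text \<open>Twice the usual \<open>- cos (pi / k)\<close>; the entry \<open>1\<close> gives the
  diagonal value \<open>2\<close>.\<close>

definition coxeter_cartan :: "enat \<Rightarrow> real" where
  "coxeter_cartan e = (case e of enat k \<Rightarrow> - 2 * cos (pi / real k) | \<infinity> \<Rightarrow> - 2)"

lemma coxeter_cartan_nonpos:
  assumes "2 \<le> e" shows "coxeter_cartan e \<le> 0"
proof (cases e)
  case (enat k)
  then have "2 \<le> k" using assms by (simp add: numeral_eq_enat)
  then have "0 \<le> cos (pi / real k)"
    by (intro cos_ge_zero) (auto simp: field_simps intro: order_trans[of _ 0])
  then show ?thesis using enat by (simp add: coxeter_cartan_def)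
qed (simp add: coxeter_cartan_def)

lemma coxeter_cartan_neg:
  assumes "2 < e" shows "coxeter_cartan e < 0"
proof (cases e)
  case (enat k)
  then have "2 < k" using assms by (simp add: numeral_eq_enat)
  then have "0 < cos (pi / real k)"
    by (intro cos_gt_zero) (auto simp: field_simps)
  then show ?thesis using enat by (simp add: coxeter_cartan_def)
qed (simp add: coxeter_cartan_def)

text \<open>For a finite entry \<open>l\<close> and \<open>\<theta> = pi / l\<close>, this is the
  sign of \<open>sin (k \<theta>)\<close> with \<open>k \<theta>\<close> at most \<open>pi\<close>;
  the infinite entry gives parameter \<open>2\<close> and value \<open>k\<close>.\<close>

lemma cheb_coxeter_cartan_nonneg:
  assumes "2 \<le> e" "enat k \<le> e"
  shows "0 \<le> cheb (- coxeter_cartan e) k"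
proof (cases e)
  case (enat l)
  define \<theta> where "\<theta> = pi / real l"
  have l: "2 \<le> l" "k \<le> l" using assms enat by (auto simp: numeral_eq_enat)
  then have "0 < \<theta>" "\<theta> < pi" by (auto simp: \<theta>_def field_simps)
  then have "0 < sin \<theta>" by (rule sin_gt_zero)
  moreover have "real k * \<theta> \<le> pi" using l by (simp add: \<theta>_def field_simps)
  then have "0 \<le> sin \<theta> * cheb (2 * cos \<theta>) k"
    unfolding cheb_cos using \<open>0 < \<theta>\<close> by (intro sin_ge_zero) auto
  ultimately show ?thesis
    using enat by (simp add: coxeter_cartan_def \<theta>_def zero_le_mult_iff)
next
  case infinity
  then show ?thesis by (simp add: coxeter_cartan_def cheb_2)
qed

lemma cheb_coxeter_cartan_zero:
  assumes "2 \<le> k"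
  shows "cheb (- coxeter_cartan (enat k)) k = 0"
proof -
  define \<theta> where "\<theta> = pi / real k"
  have "0 < \<theta>" "\<theta> < pi" using assms by (auto simp: \<theta>_def field_simps)
  then have "0 < sin \<theta>" by (rule sin_gt_zero)
  moreover have "real k * \<theta> = pi" using assms by (simp add: \<theta>_def)
  then have "sin \<theta> * cheb (2 * cos \<theta>) k = 0" unfolding cheb_cos by simp
  ultimately show ?thesis by (simp add: coxeter_cartan_def \<theta>_def)
qed

text \<open>Only the congruence on words induced by \<open>ev\<close> matters for the length
  arguments, so the target type carries no group structure.\<close>

locale coxeter_words =
  fixes n :: nat and m :: "nat \<Rightarrow> nat \<Rightarrow> enat" and ev :: "nat list \<Rightarrow> 'g"
  assumes m_diag: "i < n \<Longrightarrow> m i i = 1"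
    and m_sym: "i < n \<Longrightarrow> j < n \<Longrightarrow> m i j = m j i"
    and m_ge: "i < n \<Longrightarrow> j < n \<Longrightarrow> i \<noteq> j \<Longrightarrow> 2 \<le> m i j"
    and ev_append: "set us \<union> set us' \<union> set vs \<union> set vs' \<subseteq> {..<n} \<Longrightarrow> ev us = ev us' \<Longrightarrow> ev vs = ev vs' \<Longrightarrow>
      ev (us @ vs) = ev (us' @ vs')"
    and ev_relator: "i < n \<Longrightarrow> j < n \<Longrightarrow> m i j = enat k \<Longrightarrow> ev (concat (replicate k [i, j])) = ev []"
begin

sublocale cartan_matrix n "\<lambda>i j. coxeter_cartan (m i j)"
proof
  show "coxeter_cartan (m i i) = 2" if "i < n" for i
    using m_diag[OF that] by (simp add: coxeter_cartan_def one_enat_def)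
qed (use m_sym m_ge coxeter_cartan_nonpos in auto)

lemma act_relator:
  assumes "i < n" "j < n" "m i j = enat k"
  shows "act (concat (replicate k [i, j])) y = y"
proof (cases "i = j")
  case True
  then show ?thesis using assms m_diag[of i] by (simp add: one_enat_def)
next
  case False
  then have "cheb (- coxeter_cartan (m i j)) k = 0"
    using m_ge[of i j] assms by (simp add: cheb_coxeter_cartan_zero numeral_eq_enat)
  then show ?thesis using act_dihedral[OF assms(1,2) False, of k y] by simp
qed

end

text \<open>\<open>ev_act\<close> lets the geometric representation factor through
  \<open>ev\<close>. It is a second layer because its proof for a presented group uses
  \<open>act_relator\<close> from the first.\<close>

locale coxeter_words_action = coxeter_words n m ev
  for n :: nat and m :: "nat \<Rightarrow> nat \<Rightarrow> enat" and ev :: "nat list \<Rightarrow> 'g" +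
  assumes ev_act: "set us \<union> set vs \<subseteq> {..<n} \<Longrightarrow> ev us = ev vs \<Longrightarrow> act us x = act vs x"
begin

lemma ev_square:
  assumes "i < n" shows "ev [i, i] = ev []"
  using ev_relator[of i i 1] m_diag[OF assms] assms by (simp add: one_enat_def)

lemma ev_insert:
  assumes "set us \<union> set vs \<union> set ws \<subseteq> {..<n}" "ev ws = ev []"
  shows "ev (us @ ws @ vs) = ev (us @ vs)"
  using assms ev_append[of us us "ws @ vs" "[] @ vs"] ev_append[of ws "[]" vs vs] by simp

lemma ev_rev: "set us \<subseteq> {..<n} \<Longrightarrow> ev (rev us @ us) = ev []"
proof (induction us)
  case (Cons i us)
  then have "ev (rev us @ [i, i] @ us) = ev (rev us @ us)"
    by (intro ev_insert) (auto simp: ev_square)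
  then show ?case using Cons by simp
qed simp

lemma ev_braid:
  assumes "s < n" "t < n" "m s t = enat k"
  shows "ev (alt s t k) = ev (alt t s k)"
proof -
  \<comment> \<open>The alternating word for which \<open>X @ alt s t k\<close> is the relator; its
    reversal is \<open>alt t s k\<close>.\<close>
  define X where "X = (if even k then alt s t k else alt t s k)"
  have st: "set (alt s t j) \<subseteq> {..<n}" "set (alt t s j) \<subseteq> {..<n}" for j
    using set_alt[of s t j] set_alt[of t s j] assms by auto
  have X: "set X \<subseteq> {..<n}" using st by (simp add: X_def)
  have rX: "rev X = alt t s k" unfolding X_def by (rule rev_alt)
  have "X @ alt s t k = concat (replicate k [s, t])"
    unfolding concat_replicate_alt X_def using alt_add[of s t k k] by (simp add: mult_2)
  then have 1: "ev (X @ alt s t k) = ev []"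
    using ev_relator[OF assms] by simp
  have "ev ([] @ (rev X @ X) @ alt s t k) = ev ([] @ alt s t k)"
    using X st by (intro ev_insert) (auto simp: ev_rev)
  moreover have "ev (rev X @ (X @ alt s t k) @ []) = ev (rev X @ [])"
    using X st 1 by (intro ev_insert) auto
  ultimately show ?thesis using rX by simp
qed

section \<open>Length, signs of roots and faithfulness\<close>

definition len :: "'g \<Rightarrow> nat" where
  "len g = (LEAST k. \<exists>ks. set ks \<subseteq> {..<n} \<and> length ks = k \<and> ev ks = g)"

lemma len_le: "set ks \<subseteq> {..<n} \<Longrightarrow> len (ev ks) \<le> length ks"
  unfolding len_def by (rule Least_le) blast

lemma len_attained:
  assumes "set ks \<subseteq> {..<n}"
  shows "\<exists>ls. set ls \<subseteq> {..<n} \<and> length ls = len (ev ks) \<and> ev ls = ev ks"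
  unfolding len_def by (rule LeastI_ex) (use assms in blast)

lemma len_append_le:
  assumes "set us \<union> set vs \<subseteq> {..<n}"
  shows "len (ev (us @ vs)) \<le> len (ev us) + length vs"
proof -
  obtain ls where ls: "set ls \<subseteq> {..<n}" "length ls = len (ev us)" "ev ls = ev us"
    using len_attained[of us] assms by auto
  then have "ev (us @ vs) = ev (ls @ vs)"
    using assms by (intro ev_append) auto
  then show ?thesis using len_le[of "ls @ vs"] ls assms by simp
qed

lemma ev_cancel_snoc: "set us \<subseteq> {..<n} \<Longrightarrow> i < n \<Longrightarrow> ev (us @ [i] @ [i]) = ev us"
  using ev_insert[of us "[]" "[i, i]"] ev_square by simp

text \<open>The element is split as \<open>v\<close> times a maximal alternating word in \<open>s\<close> and a second generator
  \<open>t\<close>, which reduces the claim to \<open>v\<close> and the dihedral group generated by \<open>s\<close> and \<open>t\<close>.\<close>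

lemma nonneg_of_len:
  assumes "set ks \<subseteq> {..<n}" "s < n" "len (ev ks) \<le> len (ev (ks @ [s]))"
  shows "nonneg (act ks (bvec s))"
  using assms
proof (induction "len (ev ks)" arbitrary: ks s rule: less_induct)
  case less
  note ks = less.prems(1) and s = less.prems(2)
  obtain ls where ls: "set ls \<subseteq> {..<n}" "length ls = len (ev ks)" "ev ls = ev ks"
    using len_attained[OF ks] by blast
  show ?case
  proof (cases ls rule: rev_cases)
    case Nil
    then have "act ks (bvec s) = bvec s"
      using ev_act[of ks "[]" "bvec s"] ks ls by simp
    then show ?thesis by (simp add: nonneg_bvec)
  next
    case (snoc us t)
    have t: "t < n" and us: "set us \<subseteq> {..<n}" using ls snoc by auto
    have ust: "len (ev (ls @ [t])) \<le> length us"
      using ev_cancel_snoc[OF us t] len_le[OF us] snoc by simp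
    have "t \<noteq> s"
    proof
      assume "t = s"
      moreover have "ev (ls @ [s]) = ev (ks @ [s])" using ls ks s by (intro ev_append) auto
      ultimately show False using ust ls snoc less.prems(3) by simp
    qed
    define P where "P k \<longleftrightarrow> (\<exists>v. set v \<subseteq> {..<n} \<and> ev (v @ alt s t k) = ev ks \<and>
      len (ev v) + k = len (ev ks))" for k
    have st: "set (alt s t k) \<subseteq> {..<n}" for k using set_alt[of s t k] s t by auto
    have "P 1"
      unfolding P_def
    proof (intro exI[of _ us] conjI)
      show "ev (us @ alt s t 1) = ev ks" using snoc ls by simp
      have "len (ev (us @ [t])) \<le> len (ev us) + 1" using len_append_le[of us "[t]"] us t by simp
      then show "len (ev us) + 1 = len (ev ks)"
        using len_le[OF us] snoc ls by simp
    qed (rule us)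
    moreover have bound: "k \<le> len (ev ks)" if "P k" for k using that by (auto simp: P_def)
    ultimately obtain k where k: "P k" "1 \<le> k" and max: "\<And>l. P l \<Longrightarrow> l \<le> k"
      using Nat.nat_le_linear GreatestI_nat[of P 1 "len (ev ks)"] Greatest_le_nat[of P _ "len (ev ks)"]
      by metis
    obtain v where v: "set v \<subseteq> {..<n}" "ev (v @ alt s t k) = ev ks" "len (ev v) + k = len (ev ks)"
      using k by (auto simp: P_def)
    have less_v: "len (ev v) < len (ev ks)" using v k by simp
    obtain k' where k': "k = Suc k'" using k by (cases k) auto
    define x where "x = (if even k' then t else s)"
    define y where "y = (if even k' then s else t)"
    have alt_x: "alt s t k = x # alt s t k'" using alt_Cons[of s t k'] by (simp add: k' x_def)
    have alt_y: "alt s t (Suc k) = y # alt s t k" using alt_Cons[of s t k] by (simp add: k' y_def)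
    have xy: "x < n" "y < n" using s t by (auto simp: x_def y_def)
    have "nonneg (act v (bvec x))"
    proof (rule less.hyps[OF less_v v(1) xy(1)], rule ccontr)
      assume *: "\<not> len (ev v) \<le> len (ev (v @ [x]))"
      have "ev ks = ev ((v @ [x]) @ alt s t k')" using v alt_x by simp
      then have "len (ev ks) \<le> len (ev (v @ [x])) + k'"
        using len_append_le[of "v @ [x]" "alt s t k'"] v st xy by simp
      then show False using * v k' by simp
    qed
    \<comment> \<open>\<open>y\<close> is the letter that extends the alternating word on the left;
      if it shortened \<open>v\<close>, a longer alternating part could be split off, against the
      maximality of \<open>k\<close>.\<close>
    moreover have "nonneg (act v (bvec y))"
    proof (rule less.hyps[OF less_v v(1) xy(2)], rule ccontr)
      assume *: "\<not> len (ev v) \<le> len (ev (v @ [y]))"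
      have e: "ev ((v @ [y]) @ alt s t (Suc k)) = ev ks"
      proof -
        have "ev (v @ [y, y] @ alt s t k) = ev (v @ alt s t k)"
          using v st xy by (intro ev_insert) (auto simp: ev_square)
        then show ?thesis using v by (simp add: alt_y del: alt.simps)
      qed
      have "len (ev ks) \<le> len (ev (v @ [y])) + Suc k"
        using len_append_le[of "v @ [y]" "alt s t (Suc k)"] e v st[of "Suc k"] xy by simp
      then have "P (Suc k)"
        unfolding P_def using * v e xy by (intro exI[of _ "v @ [y]"]) auto
      then show False using max[of "Suc k"] by simp
    qed
    ultimately have nn: "nonneg (act v (bvec s))" "nonneg (act v (bvec t))"
      by (auto simp: x_def y_def split: if_splits)
    \<comment> \<open>For \<open>k >= m s t\<close> the braid relation would make the alternating
      part end in \<open>s\<close>, and then appending \<open>s\<close> would shorten the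
      element.\<close>
    have short: "enat (Suc k) \<le> m s t"
    proof (rule ccontr)
      assume "\<not> enat (Suc k) \<le> m s t"
      then obtain l where l: "m s t = enat l" "l \<le> k" by (cases "m s t") auto
      have "2 \<le> l" using m_ge[OF s t] \<open>t \<noteq> s\<close> l by (auto simp: numeral_eq_enat)
      then obtain l' where l': "l = Suc l'" by (cases l) auto
      define pre where "pre = (if even l then alt s t (k - l) else alt t s (k - l))"
      have pre: "set pre \<subseteq> {..<n}" "length pre = k - l"
        using set_alt[of s t "k - l"] set_alt[of t s "k - l"] s t by (auto simp: pre_def)
      have "alt s t k = pre @ alt s t l" using alt_add[of s t "k - l" l] l by (simp add: pre_def)
      then have "ev ks = ev ((v @ pre) @ alt s t l)" using v by simp
      also have "\<dots> = ev ((v @ pre) @ alt t s l)"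
        using v pre st set_alt[of t s l] s t ev_braid[OF s t l(1)] by (intro ev_append) auto
      finally have e: "ev ks = ev ((v @ pre @ alt s t l') @ [s])" by (simp add: l')
      have sub: "set (v @ pre @ alt s t l') \<subseteq> {..<n}" using v pre st by auto
      have "ev (ks @ [s]) = ev (((v @ pre @ alt s t l') @ [s]) @ [s])"
        using e sub ks s by (intro ev_append) auto
      also have "\<dots> = ev (v @ pre @ alt s t l')"
        using ev_cancel_snoc[OF sub s] by simp
      finally have "len (ev (ks @ [s])) \<le> len (ev v) + (k - l + l')"
        using len_append_le[of v "pre @ alt s t l'"] v pre st by simp
      then show False using less.prems(3) v l l' by simp
    qed
    have cs: "0 \<le> cheb (- coxeter_cartan (m s t)) k" "0 \<le> cheb (- coxeter_cartan (m s t)) (Suc k)"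
      using cheb_coxeter_cartan_nonneg[OF m_ge[OF s t]] \<open>t \<noteq> s\<close> short order_trans[OF _ short, of "enat k"]
      by simp_all
    have "act ks (bvec s) = act v (act (alt s t k) (bvec s))"
      using ev_act[of "v @ alt s t k" ks "bvec s"] v ks st by simp
    moreover have "nonneg (act v (\<lambda>j. p * bvec s j + q * bvec t j))" if "0 \<le> p" "0 \<le> q" for p q
      using nn that by (simp add: act_add act_scale nonneg_def)
    ultimately show ?thesis
      using act_alt[OF s t] \<open>t \<noteq> s\<close> cs by simp
  qed
qed

lemma coxeter_root_sign:
  assumes "x \<in> roots" shows "nonneg x \<or> nonpos x"
proof -
  obtain ks i where x: "x = act ks (bvec i)" "set ks \<subseteq> {..<n}" "i < n"
    using assms by (auto simp: roots_def)
  show ?thesis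
  proof (cases "len (ev ks) \<le> len (ev (ks @ [i]))")
    case True
    then show ?thesis using nonneg_of_len x by simp
  next
    case False
    then have "len (ev (ks @ [i])) \<le> len (ev ((ks @ [i]) @ [i]))"
      using ev_cancel_snoc x by simp
    then have "nonneg (act (ks @ [i]) (bvec i))"
      using x by (intro nonneg_of_len) auto
    moreover have "act (ks @ [i]) (bvec i) = (\<lambda>j. - x j)"
      using x by (simp add: reflect_eq diag act_minus)
    ultimately show ?thesis by simp
  qed
qed

text \<open>A nonempty shortest word sends the simple root of its last letter to a negative root.
  This yields faithfulness of the representation in \<open>ev_eqI\<close>.\<close>

lemma ev_eq_Nil:
  assumes "set ks \<subseteq> {..<n}" "\<And>i. i < n \<Longrightarrow> nonneg (act ks (bvec i))"
  shows "ev ks = ev []"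
proof -
  obtain ls where ls: "set ls \<subseteq> {..<n}" "length ls = len (ev ks)" "ev ls = ev ks"
    using len_attained[OF assms(1)] by blast
  show ?thesis
  proof (cases ls rule: rev_cases)
    case Nil
    then show ?thesis using ls by simp
  next
    case (snoc us t)
    have t: "t < n" and us: "set us \<subseteq> {..<n}" using ls snoc by auto
    have "len (ev us) \<le> len (ev (us @ [t]))"
      using len_le[OF us] snoc ls by simp
    then have "nonneg (act us (bvec t))" using us t by (intro nonneg_of_len) auto
    moreover have "act ks (bvec t) = (\<lambda>j. - act us (bvec t) j)"
      using ev_act[of ks "us @ [t]" "bvec t"] ls snoc assms(1) t
      by (simp add: reflect_eq diag act_minus)
    then have "nonpos (act us (bvec t))" using assms(2)[OF t] by simp
    ultimately show ?thesis
      using root_sign_unique[OF act_root[OF bvec_root[OF t] us]] by simp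
  qed
qed

lemma ev_eqI:
  assumes "set ks \<subseteq> {..<n}" "set ls \<subseteq> {..<n}" "\<And>i. i < n \<Longrightarrow> act ks (bvec i) = act ls (bvec i)"
  shows "ev ks = ev ls"
proof -
  have 1: "ev (rev ls @ ks) = ev []"
    using assms by (intro ev_eq_Nil) (auto simp: nonneg_bvec)
  have 2: "ev (ls @ rev ls) = ev []" using ev_rev[of "rev ls"] assms by simp
  have "ev ([] @ (ls @ rev ls) @ ks) = ev ([] @ ks)"
    using assms 2 by (intro ev_insert) auto
  moreover have "ev (ls @ (rev ls @ ks) @ []) = ev (ls @ [])"
    using assms 1 by (intro ev_insert) auto
  ultimately show ?thesis by simp
qed

end

section \<open>Centralizers in Coxeter groups\<close>

lemma (in monoid) list_prod_closed: "set xs \<subseteq> carrier G \<Longrightarrow> list_prod G xs \<in> carrier G"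
  by (induction xs) (auto simp: list_prod_def)

lemma (in monoid) list_prod_append:
  "set xs \<union> set ys \<subseteq> carrier G \<Longrightarrow> list_prod G (xs @ ys) = list_prod G xs \<otimes> list_prod G ys"
proof (induction xs)
  case (Cons x xs)
  then show ?case
    using list_prod_closed[of xs] list_prod_closed[of ys] by (simp add: list_prod_def m_assoc)
qed (use list_prod_closed in \<open>simp add: list_prod_def\<close>)

locale ordered_coxeter_system =
  fixes W :: "('a, 'b) monoid_scheme" and S :: "'a set" and m :: "'a \<Rightarrow> 'a \<Rightarrow> enat" and xs :: "'a list"
  assumes system: "coxeter_system W S m"
    and xs: "distinct xs" "set xs = S"
begin

abbreviation "n \<equiv> length xs"

definition ev :: "nat list \<Rightarrow> 'a" where
  "ev ks = list_prod W (map ((!) xs) ks)"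

lemma presented: "presented_by W S (coxeter_relators S m)"
  and matrix: "coxeter_matrix S m"
  using system by (auto simp: coxeter_system_def)

lemma group_W: "group W" and S_carrier: "S \<subseteq> carrier W" and generate_S: "generate W S = carrier W"
  using presented by (auto simp: presented_by_def)

sublocale W: group W by (rule group_W)

lemma nth_S: "i < n \<Longrightarrow> xs ! i \<in> S"
  using xs by auto

lemma map_nth_carrier: "set ks \<subseteq> {..<n} \<Longrightarrow> set (map ((!) xs) ks) \<subseteq> carrier W"
  using nth_S S_carrier by auto

lemma ev_closed: "set ks \<subseteq> {..<n} \<Longrightarrow> ev ks \<in> carrier W"
  unfolding ev_def by (intro W.list_prod_closed map_nth_carrier)

lemma ev_append_mult: "set us \<union> set vs \<subseteq> {..<n} \<Longrightarrow> ev (us @ vs) = ev us \<otimes>\<^bsub>W\<^esub> ev vs"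
  unfolding ev_def map_append using map_nth_carrier by (intro W.list_prod_append) auto

lemma ev_Nil [simp]: "ev [] = \<one>\<^bsub>W\<^esub>"
  by (simp add: ev_def list_prod_def)

definition to_word :: "nat list \<Rightarrow> 'a word" where
  "to_word ks = map (\<lambda>i. (xs ! i, True)) ks"

lemma to_word_words: "set ks \<subseteq> {..<n} \<Longrightarrow> to_word ks \<in> words S"
  using nth_S by (auto simp: to_word_def words_def subset_iff)

lemma eval_to_word: "eval_word W (to_word ks) = ev ks"
  by (simp add: eval_word_def to_word_def ev_def comp_def)

lemma ev_eq_iff:
  "set us \<union> set vs \<subseteq> {..<n} \<Longrightarrow> ev us = ev vs \<longleftrightarrow> word_equiv S (coxeter_relators S m) (to_word us) (to_word vs)"
  using presented to_word_words[of us] to_word_words[of vs]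
  unfolding presented_by_def eval_to_word[symmetric] by auto

lemma ev_relation:
  assumes "i < n" "j < n" "m (xs ! i) (xs ! j) = enat k"
  shows "ev (concat (replicate k [i, j])) = ev []"
proof -
  have sub: "set (concat (replicate k [i, j])) \<subseteq> {..<n}" using assms by auto
  have eq: "to_word (concat (replicate k [i, j])) = concat (replicate k [(xs ! i, True), (xs ! j, True)])"
    by (induction k) (auto simp: to_word_def)
  have "to_word (concat (replicate k [i, j])) \<in> coxeter_relators S m"
    unfolding eq coxeter_relators_def using assms nth_S by blast
  then have "word_equiv S (coxeter_relators S m) ([] @ to_word (concat (replicate k [i, j])) @ []) ([] @ [])"
    using to_word_words[OF sub] by (intro word_equiv.relator) (auto simp: words_def)
  then show ?thesis
    using ev_eq_iff[of "concat (replicate k [i, j])" "[]"] sub by (simp add: to_word_def)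
qed

sublocale coxeter_words n "\<lambda>i j. m (xs ! i) (xs ! j)" ev
proof
  show "m (xs ! i) (xs ! i) = 1" if "i < n" for i
    using matrix nth_S that by (simp add: coxeter_matrix_def)
  show "m (xs ! i) (xs ! j) = m (xs ! j) (xs ! i)" if "i < n" "j < n" for i j
    using matrix nth_S that by (simp add: coxeter_matrix_def)
  show "2 \<le> m (xs ! i) (xs ! j)" if "i < n" "j < n" "i \<noteq> j" for i j
    using matrix nth_S that xs by (simp add: coxeter_matrix_def nth_eq_iff_index_eq)
  show "ev (us @ vs) = ev (us' @ vs')"
    if "set us \<union> set us' \<union> set vs \<union> set vs' \<subseteq> {..<n}" "ev us = ev us'" "ev vs = ev vs'" for us us' vs vs'
    using that by (simp add: ev_append_mult)
qed (rule ev_relation)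

definition index :: "'a \<Rightarrow> nat" where
  "index s = (THE i. i < n \<and> xs ! i = s)"

lemma index_nth: "i < n \<Longrightarrow> index (xs ! i) = i"
  unfolding index_def using xs by (intro the_equality) (auto simp: nth_eq_iff_index_eq)

lemma index_less: "s \<in> S \<Longrightarrow> index s < n" and nth_index: "s \<in> S \<Longrightarrow> xs ! index s = s"
  using xs index_nth by (metis in_set_conv_nth)+

text \<open>Signs of letters are dropped, since a generator and its formal inverse act by the same
  involution.\<close>

definition word_act :: "'a word \<Rightarrow> vec \<Rightarrow> vec" where
  "word_act u = act (map (\<lambda>(s, b). index s) u)"

lemma word_act_equiv: "word_equiv S (coxeter_relators S m) u v \<Longrightarrow> word_act u = word_act v"
proof (induction rule: word_equiv.induct)
  case (cancel u v s b)
  then show ?case using index_less[of s] by (simp add: word_act_def fun_eq_iff)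
next
  case (relator u v r)
  then obtain s t k where r: "r = concat (replicate k [(s, True), (t, True)])"
    "s \<in> S" "t \<in> S" "m s t = enat k"
    by (auto simp: coxeter_relators_def)
  have "map (\<lambda>(s, b). index s) r = concat (replicate k [index s, index t])"
    unfolding r(1) by (induction k) auto
  then have "act (map (\<lambda>(s, b). index s) r) y = y" for y
    using act_relator[of "index s" "index t" k] index_less nth_index r(2-4) by simp
  then show ?case
    by (intro ext) (simp add: word_act_def)
qed auto

sublocale coxeter_words_action n "\<lambda>i j. m (xs ! i) (xs ! j)" ev
proof
  fix us vs x
  assume sub: "set us \<union> set vs \<subseteq> {..<n}" and "ev us = ev vs"
  then have "word_act (to_word us) = word_act (to_word vs)"
    using ev_eq_iff word_act_equiv by blast
  moreover have "map (\<lambda>(s, b). index s) (to_word ks) = ks" if "set ks \<subseteq> {..<n}" for ks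
    using that by (simp add: to_word_def comp_def subset_iff index_nth map_idI)
  ultimately show "act us x = act vs x"
    using sub by (simp add: word_act_def)
qed

lemma ev_surj: "g \<in> carrier W \<Longrightarrow> \<exists>ks. set ks \<subseteq> {..<n} \<and> g = ev ks"
  unfolding generate_S[symmetric]
proof (induction rule: generate.induct)
  case one
  show ?case by (intro exI[of _ "[]"]) simp
next
  case (incl h)
  then show ?case
    using index_less nth_index S_carrier
    by (intro exI[of _ "[index h]"]) (auto simp: ev_def list_prod_def)
next
  case (inv h)
  then have h: "h \<in> carrier W" "index h < n" "xs ! index h = h"
    using index_less nth_index S_carrier by auto
  then have "h \<otimes>\<^bsub>W\<^esub> h = \<one>\<^bsub>W\<^esub>"
    using ev_square[of "index h"] by (simp add: ev_def list_prod_def)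
  then have "inv\<^bsub>W\<^esub> h = h" using h W.inv_equality by blast
  then show ?case
    using h by (intro exI[of _ "[index h]"]) (auto simp: ev_def list_prod_def)
next
  case (eng g h)
  then obtain ks ls where "set ks \<subseteq> {..<n}" "g = ev ks" "set ls \<subseteq> {..<n}" "h = ev ls" by blast
  then show ?case
    by (intro exI[of _ "ks @ ls"]) (simp add: ev_append_mult)
qed

lemma infinite_roots_of_infinite:
  assumes "infinite (carrier W)" shows "infinite roots"
proof
  assume fin: "finite roots"
  \<comment> \<open>By \<open>ev_eqI\<close> an element is determined by the images of the simple
    roots; \<Psi> recovers it from them.\<close>
  define \<Psi> where "\<Psi> f = ev (SOME ks. set ks \<subseteq> {..<n} \<and> (\<forall>i<n. act ks (bvec i) = f i))" for f
  have "carrier W \<subseteq> \<Psi> ` (PiE {..<n} (\<lambda>_. roots))"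
  proof
    fix g assume "g \<in> carrier W"
    then obtain ks where ks: "set ks \<subseteq> {..<n}" "g = ev ks" using ev_surj by blast
    define f where "f = (\<lambda>i\<in>{..<n}. act ks (bvec i))"
    define ls where "ls = (SOME ks. set ks \<subseteq> {..<n} \<and> (\<forall>i<n. act ks (bvec i) = f i))"
    have "set ls \<subseteq> {..<n} \<and> (\<forall>i<n. act ls (bvec i) = f i)"
      unfolding ls_def by (rule someI[of _ ks]) (use ks in \<open>simp add: f_def\<close>)
    then have "\<Psi> f = g"
      unfolding \<Psi>_def ls_def[symmetric] ks using ks by (intro ev_eqI) (auto simp: f_def)
    moreover have "f \<in> PiE {..<n} (\<lambda>_. roots)"
      using ks by (auto simp: f_def intro!: rootsI)
    ultimately show "g \<in> \<Psi> ` (PiE {..<n} (\<lambda>_. roots))" by blast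
  qed
  then have "finite (carrier W)"
    by (rule finite_subset) (simp add: finite_PiE fin)
  then show False using assms by blast
qed

text \<open>A diagram edge has label greater than \<open>2\<close>, hence a nonzero matrix entry, so
  a path starting in \<open>I\<close> cannot leave it.\<close>

lemma irreducible_connected:
  assumes irr: "coxeter_irreducible S m" and I: "I \<subseteq> {..<n}"
    and zero: "\<And>i j. i \<in> I \<Longrightarrow> j < n \<Longrightarrow> j \<notin> I \<Longrightarrow> coxeter_cartan (m (xs ! i) (xs ! j)) = 0"
  shows "I = {} \<or> I = {..<n}"
proof (rule ccontr)
  assume "\<not> ?thesis"
  then obtain i j where ij: "i \<in> I" "j < n" "j \<notin> I" using I by blast
  then have "(xs ! i, xs ! j) \<in> (coxeter_diagram S m)\<^sup>*"
    using irr nth_S I by (auto simp: coxeter_irreducible_def)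
  then have "index (xs ! j) \<in> I"
  proof (induction rule: rtrancl_induct)
    case base
    then show ?case using ij I index_nth by auto
  next
    case (step s t)
    then have st: "s \<in> S" "t \<in> S" "2 < m s t" by (auto simp: coxeter_diagram_def)
    then show ?case
      using zero[of "index s" "index t"] step.IH coxeter_cartan_neg[of "m s t"]
      by (auto simp: nth_index index_less)
  qed
  then show False using ij by (simp add: index_nth)
qed

text \<open>Commutation passes to the action by \<open>ev_act\<close>,
  \<open>centralizer_cox\<close> produces a power of the Coxeter element there, and
  \<open>ev_eqI\<close> brings the equality back to \<open>W\<close>.\<close>

lemma centralizer_standard:
  assumes "infinite (carrier W)" "coxeter_irreducible S m"
    and g: "g \<in> carrier W" "g \<otimes>\<^bsub>W\<^esub> list_prod W xs = list_prod W xs \<otimes>\<^bsub>W\<^esub> g"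
  shows "\<exists>k :: int. g = list_prod W xs [^]\<^bsub>W\<^esub> k"
proof -
  interpret infinite_coxeter_roots n "\<lambda>i j. coxeter_cartan (m (xs ! i) (xs ! j))"
  proof
    show "nonneg x \<or> nonpos x" if "x \<in> roots" for x using that by (rule coxeter_root_sign)
    show "infinite roots" using assms(1) by (rule infinite_roots_of_infinite)
    show "I = {} \<or> I = {..<n}"
      if "I \<subseteq> {..<n}" "\<And>i j. i \<in> I \<Longrightarrow> j < n \<Longrightarrow> j \<notin> I \<Longrightarrow> coxeter_cartan (m (xs ! i) (xs ! j)) = 0" for I
      using irreducible_connected[OF assms(2) that] by blast
  qed
  define d where "d = list_prod W xs"
  have d: "d = ev [0..<n]" by (simp add: d_def ev_def map_nth)
  have upt: "set [0..<n] \<subseteq> {..<n}" by auto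
  have dW: "d \<in> carrier W" using ev_closed[OF upt] by (simp add: d)
  obtain ks where ks: "set ks \<subseteq> {..<n}" "g = ev ks" using ev_surj[OF g(1)] by blast
  have "ev (ks @ [0..<n]) = ev ([0..<n] @ ks)"
    using g(2) ks upt by (simp add: ev_append_mult d_def[symmetric] d)
  then have "act (ks @ [0..<n]) x = act ([0..<n] @ ks) x" for x
    using ks upt by (intro ev_act) auto
  then have "centralizes ks" using ks by (simp add: centralizes_def cox_1)
  then obtain k where k: "\<And>x. supported {..<n} x \<Longrightarrow> act ks x = cox k x"
    using centralizer_cox by blast
  have pow: "ev (concat (replicate l [0..<n])) = d [^]\<^bsub>W\<^esub> (l :: nat)" for l
  proof (induction l)
    case (Suc l)
    have "set (concat (replicate l [0..<n])) \<subseteq> {..<n}" by auto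
    then show ?case
      using Suc upt dW W.nat_pow_Suc2 by (simp add: ev_append_mult d)
  qed simp
  have word: "ev (cox_word k) = d [^]\<^bsub>W\<^esub> k"
  proof (cases "0 \<le> k")
    case True
    then have "cox_word k = concat (replicate (nat k) [0..<n])" by (simp add: cox_word_def)
    moreover have "d [^]\<^bsub>W\<^esub> k = d [^]\<^bsub>W\<^esub> nat k"
      using True int_pow_int[of W d "nat k"] by simp
    ultimately show ?thesis using pow by simp
  next
    case False
    define c where "c = concat (replicate (nat (- k)) [0..<n])"
    have c: "set c \<subseteq> {..<n}" by (auto simp: c_def)
    have "cox_word k = rev c"
      using False by (simp add: cox_word_def c_def rev_concat)
    then have "ev (cox_word k) \<otimes>\<^bsub>W\<^esub> ev c = \<one>\<^bsub>W\<^esub>"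
      using ev_rev[OF c] c by (simp add: ev_append_mult)
    then have "ev (cox_word k) = inv\<^bsub>W\<^esub> (ev c)"
      using W.inv_equality[of "ev (cox_word k)" "ev c"] ev_closed[OF c] ev_closed[OF set_cox_word] by simp
    moreover have "ev c = d [^]\<^bsub>W\<^esub> nat (- k)" unfolding c_def by (rule pow)
    moreover have "d [^]\<^bsub>W\<^esub> k = inv\<^bsub>W\<^esub> (d [^]\<^bsub>W\<^esub> nat (- k))"
      using False W.int_pow_neg_int[OF dW, of "nat (- k)"] by simp
    ultimately show ?thesis by simp
  qed
  have "ev ks = ev (cox_word k)"
    using ks set_cox_word k supported_bvec by (intro ev_eqI) (auto simp: cox_def)
  then show ?thesis using ks word by (auto simp: d_def)
qed

end

section \<open>From standard to arbitrary Coxeter elements\<close>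

theorem theorem1p1:
  fixes W :: "('a, 'b) monoid_scheme" and S :: "'a set" and m :: "'a \<Rightarrow> 'a \<Rightarrow> enat" and c :: 'a
  assumes "coxeter_system W S m"
    and "finite S"
    and "infinite (carrier W)"
    and "coxeter_irreducible S m"
    and "coxeter_element W S c"
  shows "centralizer W c = generate W {c}"
proof -
  obtain w xs where w: "w \<in> carrier W" and xs: "distinct xs" "set xs = S"
    and c: "c = w \<otimes>\<^bsub>W\<^esub> list_prod W xs \<otimes>\<^bsub>W\<^esub> inv\<^bsub>W\<^esub> w"
    using assms(5) by (auto simp: coxeter_element_def standard_coxeter_element_def)
  interpret ordered_coxeter_system W S m xs
    by unfold_locales (use assms(1) xs in auto)
  define d where "d = list_prod W xs"
  have d: "d \<in> carrier W" unfolding d_def using S_carrier xs by (intro W.list_prod_closed) auto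
  have cW: "c \<in> carrier W" using w d by (simp add: c d_def)
  have conj: "(w \<otimes>\<^bsub>W\<^esub> x \<otimes>\<^bsub>W\<^esub> inv\<^bsub>W\<^esub> w) \<otimes>\<^bsub>W\<^esub> (w \<otimes>\<^bsub>W\<^esub> y \<otimes>\<^bsub>W\<^esub> inv\<^bsub>W\<^esub> w) = w \<otimes>\<^bsub>W\<^esub> (x \<otimes>\<^bsub>W\<^esub> y) \<otimes>\<^bsub>W\<^esub> inv\<^bsub>W\<^esub> w"
    if "x \<in> carrier W" "y \<in> carrier W" for x y
  proof -
    have "inv\<^bsub>W\<^esub> w \<otimes>\<^bsub>W\<^esub> (w \<otimes>\<^bsub>W\<^esub> z) = z" if "z \<in> carrier W" for z
      using that w by (simp add: W.m_assoc[symmetric])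
    then show ?thesis using that w by (simp add: W.m_assoc)
  qed
  have hom: "(\<lambda>x. w \<otimes>\<^bsub>W\<^esub> x \<otimes>\<^bsub>W\<^esub> inv\<^bsub>W\<^esub> w) \<in> hom W W"
    using w conj by (intro homI) auto
  have "centralizer W c \<subseteq> generate W {c}"
  proof
    fix g assume "g \<in> centralizer W c"
    then have g: "g \<in> carrier W" "g \<otimes>\<^bsub>W\<^esub> c = c \<otimes>\<^bsub>W\<^esub> g" by (auto simp: centralizer_def)
    \<comment> \<open>Conjugating back by \<open>w\<close> gives an element commuting with the
      standard element \<open>d\<close>; the homomorphism \<open>hom\<close> later carries its power
      of \<open>d\<close> to a power of \<open>c\<close>.\<close>
    define h where "h = inv\<^bsub>W\<^esub> w \<otimes>\<^bsub>W\<^esub> g \<otimes>\<^bsub>W\<^esub> w"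
    have h: "h \<in> carrier W" using g w by (simp add: h_def)
    have gh: "g = w \<otimes>\<^bsub>W\<^esub> h \<otimes>\<^bsub>W\<^esub> inv\<^bsub>W\<^esub> w"
    proof -
      have "w \<otimes>\<^bsub>W\<^esub> (inv\<^bsub>W\<^esub> w \<otimes>\<^bsub>W\<^esub> z) = z" if "z \<in> carrier W" for z
        using that w by (simp add: W.m_assoc[symmetric])
      then show ?thesis using g w by (simp add: h_def W.m_assoc)
    qed
    have "w \<otimes>\<^bsub>W\<^esub> (h \<otimes>\<^bsub>W\<^esub> d) \<otimes>\<^bsub>W\<^esub> inv\<^bsub>W\<^esub> w = w \<otimes>\<^bsub>W\<^esub> (d \<otimes>\<^bsub>W\<^esub> h) \<otimes>\<^bsub>W\<^esub> inv\<^bsub>W\<^esub> w"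
      using g(2) conj[OF h d] conj[OF d h] by (simp add: c d_def[symmetric] gh[symmetric])
    then have "h \<otimes>\<^bsub>W\<^esub> d = d \<otimes>\<^bsub>W\<^esub> h"
      using h d w by simp
    then obtain k :: int where "h = d [^]\<^bsub>W\<^esub> k"
      using centralizer_standard[OF assms(3,4) h] by (auto simp: d_def)
    then have "g = c [^]\<^bsub>W\<^esub> k"
      using hom_int_pow[OF hom d group_W group_W, of k] gh by (simp add: c d_def)
    then show "g \<in> generate W {c}" using W.generate_pow[OF cW] by blast
  qed
  moreover have "generate W {c} \<subseteq> centralizer W c"
  proof
    fix g assume "g \<in> generate W {c}"
    then obtain k :: int where k: "g = c [^]\<^bsub>W\<^esub> k" using W.generate_pow[OF cW] by blast
    have "c [^]\<^bsub>W\<^esub> k \<otimes>\<^bsub>W\<^esub> c = c \<otimes>\<^bsub>W\<^esub> c [^]\<^bsub>W\<^esub> k"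
      using W.int_pow_mult[OF cW, of k 1] W.int_pow_mult[OF cW, of 1 k] cW by (simp add: add.commute)
    then show "g \<in> centralizer W c"
      using k cW by (simp add: centralizer_def)
  qed
  ultimately show ?thesis by blast
qed

end
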